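(* Let $m\ge 2$ and consider the billiard on the torus $\mathbb{T}^m=\mathbb{R}^m/\mathbb{Z}^m$ with one small obstacle $O$. Then the admissible rotation set $AR$ contains the closed ball in $\mathbb{R}^m$ centered at $\mathbf{0}$ with radius $\sqrt{2/(\ln m+5)}$.
   Context: Setting: the obstacle $O$ on $\mathbb{T}^m$ lifts to a family of pairwise disjoint sets $O_{\mathbf{k}}=O_{\mathbf{0}}+\mathbf{k}$, $\mathbf{k}\in\mathbb{Z}^m$, in $\mathbb{R}^m$, where $O_{\mathbf{0}}$ is compact, has nonempty interior and smooth boundary, and is strictly convex (convex, with boundary containing no straight line segment). $O$ is small if it is contained in a closed ball of radius smaller than $\sqrt{2}/4$ (the lifting is then chosen so that $O_{\mathbf{k}}$ is contained in such a ball centered at $\mathbf{k}$). Billiard trajectories move with unit speed along straight lines outside the interiors of the obstacles and reflect from obstacle boundaries with angle of incidence equal to angle of reflection; trajectories are lifted to $\mathbb{R}^m$, and the time along a trajectory piece equals its length. A tangency is not counted as a reflection. Admissibility: $O_{\mathbf{k}}$ is between $O_{\mathbf{i}}$ and $O_{\mathbf{j}}$ if $\mathbf{k}\ne\mathbf{i},\mathbf{j}$ and $O_{\mathbf{k}}$ intersects the convex hull of $O_{\mathbf{i}}\cup O_{\mathbf{j}}$. A (finite or infinite) sequence $(\mathbf{k}_n)_{n\ge 0}$ in $\mathbb{Z}^m$ is admissible if (1) $\mathbf{k}_0=\mathbf{0}$; (2) $\mathbf{k}_{n+1}\ne\mathbf{k}_n$ for every $n$; (3) for every $n$ there is no obstacle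 between $O_{\mathbf{k}_n}$ and $O_{\mathbf{k}_{n+1}}$; (4) for every $n$ the obstacle $O_{\mathbf{k}_{n+1}}$ is not between $O_{\mathbf{k}_n}$ and $O_{\mathbf{k}_{n+2}}$. A trajectory piece in $\mathbb{R}^m$ has type $(\mathbf{k}_n)_{n=0}^s$ if it starts on the boundary of $O_{\mathbf{k}_0}$, reflects consecutively from $O_{\mathbf{k}_1},\dots,O_{\mathbf{k}_{s-1}}$ and ends on the boundary of $O_{\mathbf{k}_s}$ (translating so that $\mathbf{k}_0=\mathbf{0}$). The admissible rotation set $AR$ is the set of all limits of sequences $((\mathbf{y}_n-\mathbf{x}_n)/t_n)_{n=1}^\infty$ such that there is a trajectory piece of admissible type in $\mathbb{R}^m$ from $\mathbf{x}_n$ to $\mathbf{y}_n$ of length $t_n$, and $t_n\to\infty$. *)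

theory Defs
  imports "HOL-Analysis.Analysis"
begin

primrec Ck_on :: "nat \<Rightarrow> ('a::real_normed_vector \<Rightarrow> real) \<Rightarrow> 'a set \<Rightarrow> bool" where
  "Ck_on 0 f U \<longleftrightarrow> continuous_on U f"
| "Ck_on (Suc k) f U \<longleftrightarrow>
     f differentiable_on U \<and> (\<forall>h. Ck_on k (\<lambda>x. frechet_derivative f (at x) h) U)"

text \<open>Meaningful for open \<open>U\<close> in a finite-dimensional space, where it is the usual
  class \<open>C\<close>-infinity (all iterated directional derivatives exist and are continuous).\<close>
definition smooth_fun_on :: "('a::real_normed_vector \<Rightarrow> real) \<Rightarrow> 'a set \<Rightarrow> bool" where
  "smooth_fun_on f U \<longleftrightarrow> (\<forall>k. Ck_on k f U)"

text \<open>Near \<open>p\<close>, the set \<open>S\<close> is the sublevel set \<open>f \<le> 0\<close> of a smooth submersion \<open>f\<close>.\<close>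
definition local_defining_function ::
  "('a::euclidean_space) set \<Rightarrow> 'a \<Rightarrow> 'a set \<Rightarrow> ('a \<Rightarrow> real) \<Rightarrow> bool" where
  "local_defining_function S p U f \<longleftrightarrow>
     open U \<and> p \<in> U \<and> smooth_fun_on f U \<and>
     (\<forall>x\<in>U. frechet_derivative f (at x) \<noteq> (\<lambda>h. 0)) \<and>
     S \<inter> U = {x\<in>U. f x \<le> 0}"

definition smooth_boundary :: "('a::euclidean_space) set \<Rightarrow> bool" where
  "smooth_boundary S \<longleftrightarrow> (\<forall>p\<in>frontier S. \<exists>U f. local_defining_function S p U f)"

text \<open>The unit vector in the direction of the gradient of a local defining function.\<close>
definition outer_unit_normal :: "('a::euclidean_space) set \<Rightarrow> 'a \<Rightarrow> 'a \<Rightarrow> bool" where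
  "outer_unit_normal S p \<nu> \<longleftrightarrow>
     p \<in> frontier S \<and> norm \<nu> = 1 \<and>
     (\<exists>U f c. local_defining_function S p U f \<and> c > 0 \<and>
        frechet_derivative f (at p) = (\<lambda>h. c * (\<nu> \<bullet> h)))"

definition strictly_convex :: "('a::euclidean_space) set \<Rightarrow> bool" where
  "strictly_convex S \<longleftrightarrow>
     convex S \<and> (\<forall>a b. closed_segment a b \<subseteq> frontier S \<longrightarrow> a = b)"

definition lattice_point :: "int ^ 'm \<Rightarrow> real ^ 'm" where
  "lattice_point k = (\<chi> i. real_of_int (k $ i))"

text \<open>The set \<open>Ob\<close> stands for the lift with index \<open>0\<close>; the full lift of the obstacle
  on the torus is the family of its integer translates.\<close>
definition obst :: "(real ^ 'm) set \<Rightarrow> int ^ 'm \<Rightarrow> (real ^ 'm) set" where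
  "obst Ob k = (\<lambda>x. x + lattice_point k) ` Ob"

definition torus_obstacle :: "(real ^ 'm) set \<Rightarrow> bool" where
  "torus_obstacle Ob \<longleftrightarrow>
     compact Ob \<and> interior Ob \<noteq> {} \<and> smooth_boundary Ob \<and> strictly_convex Ob \<and>
     (\<forall>k l. k \<noteq> l \<longrightarrow> obst Ob k \<inter> obst Ob l = {})"

text \<open>The ball is centred at \<open>0\<close> because the lift is normalised so that the obstacle with
  index \<open>k\<close> lies in a ball centred at \<open>k\<close>.\<close>
definition small_obstacle :: "(real ^ 'm) set \<Rightarrow> bool" where
  "small_obstacle Ob \<longleftrightarrow> (\<exists>r < sqrt 2 / 4. Ob \<subseteq> cball 0 r)"

definition obst_between :: "(real ^ 'm) set \<Rightarrow> int ^ 'm \<Rightarrow> int ^ 'm \<Rightarrow> int ^ 'm \<Rightarrow> bool" where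
  "obst_between Ob k i j \<longleftrightarrow>
     k \<noteq> i \<and> k \<noteq> j \<and> obst Ob k \<inter> convex hull (obst Ob i \<union> obst Ob j) \<noteq> {}"

text \<open>Admissibility of the finite sequence \<open>k 0, \<dots>, k s\<close>; later values of \<open>k\<close> are irrelevant.\<close>
definition admissible_seq :: "(real ^ 'm) set \<Rightarrow> nat \<Rightarrow> (nat \<Rightarrow> int ^ 'm) \<Rightarrow> bool" where
  "admissible_seq Ob s k \<longleftrightarrow>
     k 0 = 0 \<and>
     (\<forall>n<s. k (Suc n) \<noteq> k n) \<and>
     (\<forall>n<s. \<not> (\<exists>j. obst_between Ob j (k n) (k (Suc n)))) \<and>
     (\<forall>n. n + 2 \<le> s \<longrightarrow> \<not> obst_between Ob (k (n + 1)) (k n) (k (n + 2)))"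

text \<open>Arriving at \<open>p\<close> straight from \<open>a\<close> and leaving straight towards \<open>b\<close>: specular reflection
  in the tangent hyperplane, with tangential arrival excluded.\<close>
definition reflects_at :: "('a::euclidean_space) set \<Rightarrow> 'a \<Rightarrow> 'a \<Rightarrow> 'a \<Rightarrow> bool" where
  "reflects_at S a p b \<longleftrightarrow>
     (\<exists>\<nu>. outer_unit_normal S p \<nu> \<and> sgn (p - a) \<bullet> \<nu> \<noteq> 0 \<and>
        sgn (b - p) = sgn (p - a) - (2 * (sgn (p - a) \<bullet> \<nu>)) *\<^sub>R \<nu>)"

text \<open>A trajectory piece from \<open>x\<close> to \<open>y\<close> of length \<open>t\<close> and type \<open>k 0, \<dots>, k s\<close>, given by its
  endpoints and successive reflection points \<open>p 0, \<dots>, p s\<close>. Types are taken up to the integer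
  translation \<open>l\<close>. Segments may touch obstacles tangentially without this being recorded.\<close>
definition trajectory_piece ::
  "(real ^ 'm) set \<Rightarrow> nat \<Rightarrow> (nat \<Rightarrow> int ^ 'm) \<Rightarrow> real ^ 'm \<Rightarrow> real ^ 'm \<Rightarrow> real \<Rightarrow> bool" where
  "trajectory_piece Ob s k x y t \<longleftrightarrow>
     (\<exists>l p. p 0 = x \<and> p s = y \<and>
        (\<forall>i\<le>s. p i \<in> frontier (obst Ob (l + k i))) \<and>
        (\<forall>i<s. \<forall>j. closed_segment (p i) (p (Suc i)) \<inter> interior (obst Ob j) = {}) \<and>
        (\<forall>i. 0 < i \<and> i < s \<longrightarrow>
           reflects_at (obst Ob (l + k i)) (p (i - 1)) (p i) (p (i + 1))) \<and>
        t = (\<Sum>i<s. dist (p i) (p (Suc i))))"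

definition admissible_rotation_set :: "(real ^ 'm) set \<Rightarrow> (real ^ 'm) set" where
  "admissible_rotation_set Ob =
     {v. \<exists>x y t.
        (\<forall>n. \<exists>s k. admissible_seq Ob s k \<and> trajectory_piece Ob s k (x n) (y n) (t n)) \<and>
        filterlim t at_top sequentially \<and>
        (\<lambda>n. (y n - x n) /\<^sub>R t n) \<longlonglongrightarrow> v}"

end

theory Submission
  imports Defs
begin

text \<open>Trajectories come from minimising length. Given an admissible sequence of obstacles, a shortest
  broken line through them exists by compactness. At each corner Fermat's principle gives the law of
  reflection, and admissibility together with minimality keeps the line out of all obstacle interiors
  (\<open>shortest_path_is_trajectory\<close>). The length of this trajectory is at most the sum of the lengths
  of the lattice steps.

  For a small obstacle, a sequence whose steps are nonzero vectors with entries \<open>-1, 0, 1\<close> is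
  admissible as soon as consecutive steps have nonpositive inner product
  (\<open>obtuse_ternary_steps_admissible\<close>), because the relevant lattice points stay at distance
  \<open>sqrt 2 / 2\<close> from the segments in question. What remains is to see how far such walks get.
  Alternating between two orthogonal steps \<open>u, w\<close> moves along \<open>u + w\<close> at speed at least
  \<open>1 / sqrt 2\<close>, and every ternary vector \<open>z\<close> is a multiple of such a sum
  (\<open>attainable_ternary\<close>). Walks can be concatenated at bounded cost, so any nonnegative
  combination \<open>v\<close> of ternary vectors \<open>z k\<close> with weights \<open>c k\<close> is reached, per unit of time, if the
  sum of all \<open>c k * sqrt 2 * norm (z k)\<close> is at most \<open>1\<close>. Slicing \<open>v\<close> by the size of its coordinates
  (\<open>layer_cake_decomposition\<close>) gives weights for which this sum is at most
  \<open>norm v * sqrt ((ln m + 5) / 2)\<close>, hence at most \<open>1\<close> on the ball of the theorem. Finally, trajectories that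
  arrive early are slowed down by bouncing back and forth between two obstacles
  (\<open>attainable_trajectory_of_length\<close>).\<close>

section \<open>Lattice translates of the obstacle\<close>

lemma lattice_point_add: "lattice_point (k + l) = lattice_point k + lattice_point l"
  by (simp add: lattice_point_def vec_eq_iff)

lemma lattice_point_minus: "lattice_point (- k) = - lattice_point k"
  by (simp add: lattice_point_def vec_eq_iff)

lemma lattice_point_diff: "lattice_point (k - l) = lattice_point k - lattice_point l"
  by (simp add: lattice_point_def vec_eq_iff)

lemma lattice_point_zero [simp]: "lattice_point 0 = 0"
  by (simp add: lattice_point_def vec_eq_iff)

lemma obst_eq_translation: "obst Ob k = (+) (lattice_point k) ` Ob"
  by (simp add: obst_def add.commute)

text \<open>Both sides choose from the same, possibly empty, set of derivatives.\<close>
lemma frechet_derivative_translate: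
  fixes f :: "'a::real_normed_vector \<Rightarrow> real"
  shows "frechet_derivative (\<lambda>x. f (x - a)) (at x) = frechet_derivative f (at (x - a))"
proof -
  have "((\<lambda>x. f (x - a)) has_derivative D) (at x) \<longleftrightarrow> (f has_derivative D) (at (x - a))" for D
  proof
    assume "((\<lambda>x. f (x - a)) has_derivative D) (at x)"
    then have "((\<lambda>x. f (x - a)) has_derivative D) (at ((x - a) + a))" by simp
    moreover have "((\<lambda>y. y + a) has_derivative (\<lambda>h. h)) (at (x - a))"
      by (auto intro!: derivative_eq_intros)
    ultimately show "(f has_derivative D) (at (x - a))"
      using has_derivative_compose[of "\<lambda>y. y + a" "\<lambda>h. h" "x - a" UNIV "\<lambda>x. f (x - a)" D] by simp
  next
    assume "(f has_derivative D) (at (x - a))"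
    moreover have "((\<lambda>y. y - a) has_derivative (\<lambda>h. h)) (at x)"
      by (auto intro!: derivative_eq_intros)
    ultimately show "((\<lambda>x. f (x - a)) has_derivative D) (at x)"
      using has_derivative_compose[of "\<lambda>y. y - a" "\<lambda>h. h" x UNIV f D] by simp
  qed
  then show ?thesis by (simp add: frechet_derivative_def)
qed

lemma Ck_on_translate:
  assumes "Ck_on k f U" "open U"
  shows "Ck_on k (\<lambda>x. f (x - a)) ((+) a ` U)"
  using assms(1)
proof (induction k arbitrary: f)
  case 0
  then show ?case
    by (auto intro!: continuous_on_compose2[of U f] continuous_intros)
next
  case (Suc k)
  have op: "open ((+) a ` U)" using assms(2) by (rule open_translation)
  have "(\<lambda>x. f (x - a)) differentiable (at x)" if "x - a \<in> U" for x
  proof -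
    have "f differentiable (at (x - a))"
      using Suc.prems that assms(2) by (auto simp: differentiable_on_eq_differentiable_at)
    then show ?thesis
      by (intro differentiable_compose[of f "\<lambda>x. x - a"]) (auto intro!: derivative_intros)
  qed
  then show ?case
    using Suc op by (auto simp: differentiable_on_eq_differentiable_at frechet_derivative_translate)
qed

lemma local_defining_function_translate:
  assumes "local_defining_function S p U f"
  shows "local_defining_function ((+) a ` S) (a + p) ((+) a ` U) (\<lambda>x. f (x - a))"
proof -
  have "(+) a ` S \<inter> (+) a ` U = (+) a ` (S \<inter> U)" by auto
  then show ?thesis
    using assms unfolding local_defining_function_def smooth_fun_on_def
    by (auto simp: Ck_on_translate open_translation frechet_derivative_translate)
qed

lemma smooth_boundary_translate:
  assumes "smooth_boundary S"
  shows "smooth_boundary ((+) a ` S)"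
  unfolding smooth_boundary_def
proof
  fix p assume "p \<in> frontier ((+) a ` S)"
  then obtain q where "q \<in> frontier S" "p = a + q"
    by (auto simp: frontier_translation)
  then show "\<exists>U f. local_defining_function ((+) a ` S) p U f"
    using assms local_defining_function_translate unfolding smooth_boundary_def by blast
qed

lemma smooth_boundary_obst: "torus_obstacle Ob \<Longrightarrow> smooth_boundary (obst Ob k)"
  by (simp add: torus_obstacle_def obst_eq_translation smooth_boundary_translate)

lemma compact_obst: "torus_obstacle Ob \<Longrightarrow> compact (obst Ob k)"
  by (simp add: torus_obstacle_def obst_eq_translation compact_translation)

lemma obst_nonempty: "torus_obstacle Ob \<Longrightarrow> obst Ob k \<noteq> {}"
  using interior_subset by (fastforce simp: torus_obstacle_def obst_def)

lemma obst_disjoint: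
  "torus_obstacle Ob \<Longrightarrow> x \<in> obst Ob k \<Longrightarrow> y \<in> obst Ob l \<Longrightarrow> k \<noteq> l \<Longrightarrow> x \<noteq> y"
  unfolding torus_obstacle_def by blast

section \<open>Fermat's principle at a corner\<close>

text \<open>The first variation of a distance when one endpoint moves with velocity \<open>h\<close>.\<close>
lemma has_derivative_dist_line:
  fixes a p h :: "'a::euclidean_space"
  assumes "p \<noteq> a"
  shows "((\<lambda>t. dist a (p + t *\<^sub>R h)) has_real_derivative h \<bullet> sgn (p - a)) (at 0)"
proof -
  have "((\<lambda>t::real. p + t *\<^sub>R h - a) has_derivative (\<lambda>t. t *\<^sub>R h)) (at 0)"
    by (auto intro!: derivative_eq_intros)
  moreover have "(norm has_derivative (\<lambda>h. h \<bullet> sgn (p - a))) (at (p + 0 *\<^sub>R h - a))"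
    using has_derivative_norm[of "p - a"] assms by simp
  ultimately have "((\<lambda>t. norm (p + t *\<^sub>R h - a)) has_derivative (\<lambda>t. (t *\<^sub>R h) \<bullet> sgn (p - a))) (at 0)"
    by (rule has_derivative_compose)
  then show ?thesis
    by (auto simp: has_field_derivative_def dist_norm norm_minus_commute mult.commute
        elim!: has_derivative_eq_rhs)
qed

text \<open>The Lagrange multiplier of an optimum with the single constraint gradient \<open>g\<close>: the descent
  direction to test is \<open>- (sgn G + sgn g)\<close>, which has negative inner product with both \<open>g\<close> and
  \<open>G\<close> unless the two vectors are antiparallel.\<close>
lemma opposite_of_halfspace_nonneg:
  fixes g G :: "'a::euclidean_space"
  assumes "g \<noteq> 0" and nonneg: "\<And>h. g \<bullet> h < 0 \<Longrightarrow> 0 \<le> G \<bullet> h"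
  shows "\<exists>l\<ge>0. G = - (l *\<^sub>R g)"
proof (cases "G = 0")
  case True
  then show ?thesis by (intro exI[of _ 0]) simp
next
  case False
  define h where "h = - (sgn G + sgn g)"
  have "norm (sgn G) = 1" "norm (sgn g) = 1" using False assms(1) by (simp_all add: norm_sgn)
  then have Gg: "sgn G \<bullet> sgn G = 1" "sgn g \<bullet> sgn g = 1" by (simp_all add: dot_square_norm)
  have g: "g = norm g *\<^sub>R sgn g" and G: "G = norm G *\<^sub>R sgn G"
    by (simp_all add: sgn_div_norm assms False)
  have gh: "g \<bullet> h = - norm g * (1 + sgn G \<bullet> sgn g)"
  proof -
    have "sgn g \<bullet> h = - (1 + sgn G \<bullet> sgn g)"
      by (simp add: h_def inner_add_right inner_diff_right inner_commute Gg)
    moreover have "g \<bullet> h = norm g * (sgn g \<bullet> h)" using g by (metis inner_scaleR_left)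
    ultimately show ?thesis by (simp only: mult_minus_left mult_minus_right)
  qed
  have Gh: "G \<bullet> h = - norm G * (1 + sgn G \<bullet> sgn g)"
  proof -
    have "sgn G \<bullet> h = - (1 + sgn G \<bullet> sgn g)"
      by (simp add: h_def inner_add_right inner_diff_right inner_commute Gg)
    moreover have "G \<bullet> h = norm G * (sgn G \<bullet> h)" using G by (metis inner_scaleR_left)
    ultimately show ?thesis by (simp only: mult_minus_left mult_minus_right)
  qed
  have "(norm (sgn G + sgn g))\<^sup>2 = 2 * (1 + sgn G \<bullet> sgn g)"
    by (simp add: power2_norm_eq_inner inner_add_left inner_add_right inner_commute Gg)
  moreover have "\<not> 1 + sgn G \<bullet> sgn g > 0"
  proof
    assume *: "1 + sgn G \<bullet> sgn g > 0"
    then have "g \<bullet> h < 0" using assms(1) by (simp add: gh)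
    then have "0 \<le> G \<bullet> h" by (rule nonneg)
    moreover have "0 < norm G * (1 + sgn G \<bullet> sgn g)" using False * by simp
    ultimately show False by (simp add: Gh)
  qed
  ultimately have "(norm (sgn G + sgn g))\<^sup>2 \<le> 0" by (simp only: not_less mult_le_0_iff) simp
  then have "sgn G = - sgn g" by (simp add: eq_neg_iff_add_eq_0)
  then have "G = - ((norm G / norm g) *\<^sub>R g)"
    by (subst G) (simp add: sgn_div_norm divide_inverse)
  then show ?thesis by (intro exI[of _ "norm G / norm g"]) simp
qed

lemma in_segment_if_sgn_eq:
  fixes a b p :: "'a::euclidean_space"
  assumes "sgn (p - a) = sgn (b - p)"
  shows "p \<in> closed_segment a b"
proof -
  have "norm (p - a) *\<^sub>R (b - p) = norm (b - p) *\<^sub>R (p - a)"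
  proof -
    have "p - a = norm (p - a) *\<^sub>R sgn (p - a)" "b - p = norm (b - p) *\<^sub>R sgn (b - p)"
      by (cases "p = a"; cases "p = b"; simp add: sgn_div_norm)+
    then show ?thesis using assms by (metis scaleR_scaleR mult.commute)
  qed
  then have "norm ((p - a) + (b - p)) = norm (p - a) + norm (b - p)"
    by (simp only: norm_triangle_eq)
  then have "dist a b = dist a p + dist p b"
    by (simp add: dist_norm norm_minus_commute)
  then show ?thesis by (simp add: between[symmetric] between_mem_segment)
qed

text \<open>Fermat's principle. Minimality makes the gradient \<open>sgn (p - a) + sgn (p - b)\<close> of the corner length
  a multiple of the normal, and this is the reflection law. The arrival is not tangential because
  a vanishing normal component would make the corner straight.\<close>
lemma shortest_corner_reflects:
  fixes S :: "'a::euclidean_space set"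
  assumes "smooth_boundary S" "p \<in> frontier S" "p \<in> S"
    and "p \<noteq> a" "p \<noteq> b" "p \<notin> closed_segment a b"
    and shortest: "\<And>q. q \<in> S \<Longrightarrow> dist a p + dist p b \<le> dist a q + dist q b"
  shows "reflects_at S a p b"
proof -
  obtain U f where Uf: "local_defining_function S p U f"
    using assms(1,2) unfolding smooth_boundary_def by blast
  define D where "D = frechet_derivative f (at p)"
  have U: "open U" "p \<in> U" "D \<noteq> (\<lambda>h. 0)" "S \<inter> U = {x \<in> U. f x \<le> 0}"
    using Uf unfolding local_defining_function_def D_def by auto
  have "Ck_on (Suc 0) f U"
    using Uf unfolding local_defining_function_def smooth_fun_on_def by blast
  then have "f differentiable (at p)"
    using U by (auto simp: differentiable_on_eq_differentiable_at)
  then have D: "(f has_derivative D) (at p)"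
    unfolding D_def using frechet_derivative_works by blast
  define g where "g = adjoint D 1"
  have Dg: "D h = g \<bullet> h" for h
    using adjoint_works[OF has_derivative_linear[OF D], of h 1] by (simp add: g_def inner_commute)
  have "g \<noteq> 0" using U(3) Dg by auto
  define G where "G = sgn (p - a) + sgn (p - b)"
  have "0 \<le> G \<bullet> h" if h: "g \<bullet> h < 0" for h
  proof (rule ccontr)
    assume "\<not> 0 \<le> G \<bullet> h"
    then have neg: "h \<bullet> sgn (p - a) + h \<bullet> sgn (p - b) < 0"
      by (simp add: G_def inner_add_right inner_commute[of _ h])
    have "((\<lambda>t::real. p + t *\<^sub>R h) has_derivative (\<lambda>t. t *\<^sub>R h)) (at 0)"
      by (auto intro!: derivative_eq_intros)
    then have "((\<lambda>t. f (p + t *\<^sub>R h)) has_derivative (\<lambda>t. D (t *\<^sub>R h))) (at 0)"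
      by (rule has_derivative_compose) (simp add: D)
    then have "((\<lambda>t. f (p + t *\<^sub>R h)) has_real_derivative g \<bullet> h) (at 0)"
      by (auto simp: has_field_derivative_def Dg mult.commute elim!: has_derivative_eq_rhs)
    from DERIV_neg_dec_right[OF this h]
    obtain d1 where d1: "d1 > 0" "\<And>t. 0 < t \<Longrightarrow> t < d1 \<Longrightarrow> f (p + t *\<^sub>R h) < f p"
      by auto
    have "((\<lambda>t. dist a (p + t *\<^sub>R h) + dist b (p + t *\<^sub>R h)) has_real_derivative
        h \<bullet> sgn (p - a) + h \<bullet> sgn (p - b)) (at 0)"
      by (intro derivative_intros has_derivative_dist_line assms)
    from DERIV_neg_dec_right[OF this neg]
    obtain d2 where d2: "d2 > 0" "\<And>t. 0 < t \<Longrightarrow> t < d2 \<Longrightarrow>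
        dist a (p + t *\<^sub>R h) + dist b (p + t *\<^sub>R h) < dist a p + dist b p"
      by auto
    have "((\<lambda>t::real. p + t *\<^sub>R h) \<longlongrightarrow> p + 0 *\<^sub>R h) (at_right 0)"
      by (intro tendsto_intros)
    then have "\<forall>\<^sub>F t in at_right 0. p + t *\<^sub>R h \<in> U"
      using U by (intro topological_tendstoD) auto
    moreover have "\<forall>\<^sub>F t in at_right 0. t < min d1 d2"
      using d1(1) d2(1) by (simp only: eventually_at_right_field) (intro exI[of _ "min d1 d2"], simp)
    ultimately have "\<forall>\<^sub>F t in at_right (0::real). p + t *\<^sub>R h \<in> U \<and> t < min d1 d2 \<and> 0 < t"
      using eventually_at_right_less[of 0] by eventually_elim auto
    then obtain t where t: "p + t *\<^sub>R h \<in> U" "t < min d1 d2" "0 < t"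
      using eventually_happens'[OF trivial_limit_at_right_real] by blast
    have "f p \<le> 0" using U assms(3) by blast
    then have "f (p + t *\<^sub>R h) \<le> 0" using d1(2)[of t] t by simp
    then have "p + t *\<^sub>R h \<in> S" using U t by blast
    from shortest[OF this] d2(2)[of t] t show False by (simp add: dist_commute)
  qed
  from opposite_of_halfspace_nonneg[OF \<open>g \<noteq> 0\<close> this]
  obtain l where l: "l \<ge> 0" "G = - (l *\<^sub>R g)" by blast
  have "G \<noteq> 0"
  proof
    assume "G = 0"
    then have "sgn (p - a) = sgn (b - p)"
      by (metis G_def eq_neg_iff_add_eq_0 minus_diff_eq sgn_minus)
    then show False using in_segment_if_sgn_eq assms(6) by blast
  qed
  define \<nu> where "\<nu> = sgn g"
  define c where "c = l * norm g"
  have "norm \<nu> = 1" using \<open>g \<noteq> 0\<close> by (simp add: \<nu>_def norm_sgn)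
  have "g = norm g *\<^sub>R \<nu>" by (simp add: \<nu>_def sgn_div_norm \<open>g \<noteq> 0\<close>)
  then have G: "G = - (c *\<^sub>R \<nu>)" using l(2) by (metis c_def scaleR_scaleR)
  have "c \<noteq> 0" using \<open>G \<noteq> 0\<close> G by auto
  have normal: "outer_unit_normal S p \<nu>"
    unfolding outer_unit_normal_def
  proof (intro conjI exI)
    show "local_defining_function S p U f" by (rule Uf)
    show "0 < norm g" using \<open>g \<noteq> 0\<close> by simp
    show "frechet_derivative f (at p) = (\<lambda>h. norm g * (\<nu> \<bullet> h))"
      unfolding D_def[symmetric] using Dg \<open>g = norm g *\<^sub>R \<nu>\<close> by (metis inner_scaleR_left)
  qed (use assms \<open>norm \<nu> = 1\<close> in auto)
  have out: "sgn (b - p) = sgn (p - a) + c *\<^sub>R \<nu>"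
  proof -
    have "sgn (b - p) = - sgn (p - b)" by (metis minus_diff_eq sgn_minus)
    moreover have "sgn (p - b) = - (c *\<^sub>R \<nu>) - sgn (p - a)"
      using G unfolding G_def by (simp add: eq_diff_eq add.commute)
    ultimately show ?thesis by simp
  qed
  \<comment> \<open>Both directions are unit vectors, which determines the size of the kick along \<open>\<nu>\<close>.\<close>
  have "(norm (sgn (p - a) + c *\<^sub>R \<nu>))\<^sup>2 = (norm (sgn (p - a)))\<^sup>2"
    unfolding out[symmetric] using assms by (simp add: norm_sgn)
  moreover have "(norm (\<alpha> + c *\<^sub>R \<nu>))\<^sup>2 = (norm \<alpha>)\<^sup>2 + c * (2 * (\<alpha> \<bullet> \<nu>) + c)" for \<alpha>
  proof -
    have "\<nu> \<bullet> \<nu> = 1" using \<open>norm \<nu> = 1\<close> by (simp add: dot_square_norm)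
    then show ?thesis
      unfolding power2_norm_eq_inner inner_add_left inner_add_right
      by (simp add: inner_commute[of \<nu> \<alpha>] distrib_left)
  qed
  ultimately have "c * (2 * (sgn (p - a) \<bullet> \<nu>) + c) = 0" by simp
  then have "c = - 2 * (sgn (p - a) \<bullet> \<nu>)" using \<open>c \<noteq> 0\<close> by simp
  then show ?thesis
    unfolding reflects_at_def using normal \<open>c \<noteq> 0\<close> out by (intro exI[of _ \<nu>]) auto
qed

text \<open>An interior point of \<open>S\<close> on the segment could be moved a little further along the segment
  without leaving \<open>S\<close>, so \<open>S\<close> would contain a point of the segment other than \<open>p\<close>.\<close>
lemma segment_avoids_interior:
  fixes S :: "'a::euclidean_space set"
  assumes "p \<noteq> b" and only: "S \<inter> closed_segment p b \<subseteq> {p}"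
  shows "closed_segment p b \<inter> interior S = {}"
proof (rule ccontr)
  assume "closed_segment p b \<inter> interior S \<noteq> {}"
  then obtain q where q: "q \<in> closed_segment p b" "q \<in> interior S" by blast
  then obtain t where t: "0 \<le> t" "t \<le> 1" "q = (1 - t) *\<^sub>R p + t *\<^sub>R b"
    by (auto simp: closed_segment_def)
  have "b \<notin> S" using assms by auto
  then have "q \<noteq> b" using q interior_subset by blast
  then have "t < 1" using t by (cases "t = 1") auto
  define r where "r s = (1 - s) *\<^sub>R p + s *\<^sub>R b" for s :: real
  have lim: "((\<lambda>s. r s) \<longlongrightarrow> r t) (at_right t)" unfolding r_def by (intro tendsto_intros)
  then have "\<forall>\<^sub>F s in at_right t. r s \<in> interior S"
    by (rule topological_tendstoD) (use q t in \<open>simp_all add: r_def\<close>)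
  moreover have "\<forall>\<^sub>F s in at_right t. s < 1"
    using \<open>t < 1\<close> by (auto simp: eventually_at_right_field)
  ultimately have "\<forall>\<^sub>F s in at_right t. r s \<in> interior S \<and> s < 1 \<and> t < s"
    using eventually_at_right_less[of t] by eventually_elim auto
  then obtain s where s: "r s \<in> interior S" "s < 1" "t < s"
    using eventually_happens'[OF trivial_limit_at_right_real] by blast
  have seg: "r s \<in> closed_segment p b" using s t by (auto simp: r_def closed_segment_def)
  have "r s - p = s *\<^sub>R (b - p)" by (simp add: r_def algebra_simps)
  then have "r s \<noteq> p" using s t assms(1) by auto
  then show False using only s(1) seg interior_subset by blast
qed

lemma segment_extend:
  fixes a b p :: "'a::euclidean_space"
  assumes "dist a q = dist a p + dist p q" "q \<in> closed_segment p b" "q \<noteq> p"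
  shows "p \<in> closed_segment a b"
proof -
  obtain t where t: "0 \<le> t" "q - p = t *\<^sub>R (b - p)"
    using assms(2) by (auto simp: closed_segment_def algebra_simps)
  have "t > 0" using t assms(3) by (cases "t = 0") auto
  have "norm ((p - a) + (q - p)) = norm (p - a) + norm (q - p)"
    using assms(1) by (simp add: dist_norm norm_minus_commute)
  then have "norm (p - a) *\<^sub>R (q - p) = norm (q - p) *\<^sub>R (p - a)"
    by (simp only: norm_triangle_eq)
  then have "t *\<^sub>R (norm (p - a) *\<^sub>R (b - p)) = t *\<^sub>R (norm (b - p) *\<^sub>R (p - a))"
    using \<open>t > 0\<close> by (simp add: t(2) mult.commute)
  then have "norm (p - a) *\<^sub>R (b - p) = norm (b - p) *\<^sub>R (p - a)"
    using \<open>t > 0\<close> scaleR_left_imp_eq by (metis less_irrefl)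
  then have "norm ((p - a) + (b - p)) = norm (p - a) + norm (b - p)"
    by (simp only: norm_triangle_eq)
  then have "dist a b = dist a p + dist p b"
    by (simp add: dist_norm norm_minus_commute)
  then show ?thesis by (simp add: between[symmetric] between_mem_segment)
qed

section \<open>Shortest paths are trajectories\<close>

text \<open>A path is an infinite sequence of points although only its first \<open>s\<close> hops count: the paths that
  visit the prescribed obstacles then form one compact product, whatever \<open>s\<close> is.\<close>
definition visits :: "(real ^ 'm) set \<Rightarrow> (nat \<Rightarrow> int ^ 'm) \<Rightarrow> (nat \<Rightarrow> real ^ 'm) \<Rightarrow> bool" where
  "visits Ob k p \<longleftrightarrow> (\<forall>i. p i \<in> obst Ob (k i))"

definition path_length :: "nat \<Rightarrow> (nat \<Rightarrow> real ^ 'm) \<Rightarrow> real" where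
  "path_length s p = (\<Sum>i<s. dist (p i) (p (Suc i)))"

definition shortest_path ::
  "(real ^ 'm) set \<Rightarrow> (nat \<Rightarrow> int ^ 'm) \<Rightarrow> nat \<Rightarrow> (nat \<Rightarrow> real ^ 'm) \<Rightarrow> bool" where
  "shortest_path Ob k s p \<longleftrightarrow>
     visits Ob k p \<and> (\<forall>q. visits Ob k q \<longrightarrow> path_length s p \<le> path_length s q)"

lemma shortest_path_exists:
  assumes "torus_obstacle Ob"
  shows "\<exists>p. shortest_path Ob k s p"
proof -
  define X where "X = PiE UNIV (\<lambda>i. obst Ob (k i))"
  have X: "p \<in> X \<longleftrightarrow> visits Ob k p" for p by (auto simp: X_def visits_def PiE_iff)
  have "compact X"
    using compactin_PiE[of "\<lambda>_. euclidean" "UNIV :: nat set" "\<lambda>i. obst Ob (k i)"]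
      compact_obst[OF assms]
    by (simp add: X_def euclidean_product_topology)
  moreover have "X \<noteq> {}" by (simp add: X_def PiE_eq_empty_iff obst_nonempty[OF assms])
  moreover have "continuous_on X (path_length s)"
    unfolding path_length_def
    by (intro continuous_intros continuous_on_subset[OF continuous_on_product_coordinates]) auto
  ultimately obtain p where "p \<in> X" "\<forall>q\<in>X. path_length s p \<le> path_length s q"
    using continuous_attains_inf[of X "path_length s"] by blast
  then show ?thesis unfolding shortest_path_def X[symmetric] by blast
qed

text \<open>Moving the single point \<open>p i\<close> changes only the hops that meet at \<open>i\<close>. The set of these hops is
  written so that it covers both ends of the path.\<close>
lemma shortest_path_vary:
  assumes sp: "shortest_path Ob k s p" and q: "q \<in> obst Ob (k i)"
  shows "(\<Sum>j\<in>{j. j < s \<and> (j = i \<or> Suc j = i)}. dist (p j) (p (Suc j)))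
    \<le> (\<Sum>j\<in>{j. j < s \<and> (j = i \<or> Suc j = i)}. dist ((p(i := q)) j) ((p(i := q)) (Suc j)))"
proof -
  let ?I = "{j. j < s \<and> (j = i \<or> Suc j = i)}" and ?J = "{j. j < s \<and> \<not> (j = i \<or> Suc j = i)}"
  have split: "path_length s r = (\<Sum>j\<in>?I. dist (r j) (r (Suc j))) + (\<Sum>j\<in>?J. dist (r j) (r (Suc j)))"
    for r :: "nat \<Rightarrow> real ^ 'm"
    unfolding path_length_def by (subst sum.union_disjoint[symmetric]) (auto intro: sum.cong)
  have "visits Ob k (p(i := q))" using sp q by (auto simp: shortest_path_def visits_def)
  then have "path_length s p \<le> path_length s (p(i := q))"
    using sp by (simp add: shortest_path_def)
  moreover have "(\<Sum>j\<in>?J. dist ((p(i := q)) j) ((p(i := q)) (Suc j))) = (\<Sum>j\<in>?J. dist (p j) (p (Suc j)))"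
    by (intro sum.cong) auto
  ultimately show ?thesis unfolding split by linarith
qed

lemma shortest_path_start:
  assumes "shortest_path Ob k s p" "0 < s" "q \<in> obst Ob (k 0)"
  shows "dist (p 0) (p 1) \<le> dist q (p 1)"
proof -
  have "{j. j < s \<and> (j = 0 \<or> Suc j = 0)} = {0}" using assms by auto
  then show ?thesis using shortest_path_vary[OF assms(1,3)] by simp
qed

lemma shortest_path_end:
  assumes "shortest_path Ob k (Suc s) p" "q \<in> obst Ob (k (Suc s))"
  shows "dist (p s) (p (Suc s)) \<le> dist (p s) q"
proof -
  have "{j. j < Suc s \<and> (j = Suc s \<or> Suc j = Suc s)} = {s}" by auto
  then show ?thesis using shortest_path_vary[OF assms] by simp
qed

lemma shortest_path_corner:
  assumes "shortest_path Ob k s p" "Suc i < s" "q \<in> obst Ob (k (Suc i))"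
  shows "dist (p i) (p (Suc i)) + dist (p (Suc i)) (p (Suc (Suc i)))
    \<le> dist (p i) q + dist q (p (Suc (Suc i)))"
proof -
  have "{j. j < s \<and> (j = Suc i \<or> Suc j = Suc i)} = {i, Suc i}" using assms by auto
  then show ?thesis using shortest_path_vary[OF assms(1,3)] by simp
qed

lemma segment_subset_hull:
  assumes "x \<in> obst Ob k" "y \<in> obst Ob l"
  shows "closed_segment x y \<subseteq> convex hull (obst Ob k \<union> obst Ob l)"
  using assms unfolding segment_convex_hull by (intro hull_mono) auto

text \<open>This is what the last admissibility condition is for: a straight corner would put a point of the
  middle obstacle into the convex hull of its neighbours.\<close>
lemma corner_not_straight:
  assumes adm: "admissible_seq Ob s k" and p: "visits Ob k p" and i: "Suc i < s"
  shows "p (Suc i) \<notin> closed_segment (p i) (p (Suc (Suc i)))"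
proof
  assume "p (Suc i) \<in> closed_segment (p i) (p (Suc (Suc i)))"
  then have "p (Suc i) \<in> convex hull (obst Ob (k i) \<union> obst Ob (k (Suc (Suc i))))"
    using segment_subset_hull p unfolding visits_def by blast
  moreover have "k (Suc i) \<noteq> k i" "k (Suc i) \<noteq> k (Suc (Suc i))"
    using adm i unfolding admissible_seq_def by (metis Suc_lessD)+
  ultimately have "obst_between Ob (k (Suc i)) (k i) (k (Suc (Suc i)))"
    using p unfolding obst_between_def visits_def by blast
  moreover have "i + 2 \<le> s" using i by simp
  ultimately show False using adm unfolding admissible_seq_def by auto
qed

lemma segment_point_not_closer:
  fixes b p q :: "'a::euclidean_space"
  assumes "q \<in> closed_segment p b" "dist p b \<le> dist q b"
  shows "q = p"
proof -
  have "dist p b = dist p q + dist q b"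
    using assms(1) by (simp add: between[symmetric] between_mem_segment)
  then show ?thesis using assms(2) by simp
qed

text \<open>If sliding \<open>p\<close> forward along \<open>[p, b]\<close> to \<open>q\<close> does not shorten the corner \<open>a, p, b\<close>, then
  \<open>a, p, q\<close> is an equality case of the triangle inequality, so the corner was straight.\<close>
lemma corner_point_not_advanced:
  fixes a b p :: "'a::euclidean_space"
  assumes "p \<notin> closed_segment a b" "q \<in> closed_segment p b"
    and "dist a p + dist p b \<le> dist a q + dist q b"
  shows "q = p"
proof (rule ccontr)
  assume "q \<noteq> p"
  have "dist p b = dist p q + dist q b"
    using assms(2) by (simp add: between[symmetric] between_mem_segment)
  then have "dist a q = dist a p + dist p q"
    using assms(3) dist_triangle[of a q p] by linarith
  then show False using segment_extend assms(1,2) \<open>q \<noteq> p\<close> by blast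
qed

text \<open>Obstacles other than the two at the ends of the hop are excluded by admissibility. An end obstacle
  cannot contain a further point of the hop, since sliding the path point there would be a shortcut.\<close>
lemma shortest_path_avoids_interiors:
  assumes ob: "torus_obstacle Ob" and adm: "admissible_seq Ob s k"
    and sp: "shortest_path Ob k s p" and i: "i < s"
  shows "closed_segment (p i) (p (Suc i)) \<inter> interior (obst Ob j) = {}"
proof -
  have p: "p n \<in> obst Ob (k n)" for n using sp by (simp add: shortest_path_def visits_def)
  have vis: "visits Ob k p" using sp by (simp add: shortest_path_def)
  have step: "k (Suc n) \<noteq> k n" if "n < s" for n using adm that by (simp add: admissible_seq_def)
  have ne: "p i \<noteq> p (Suc i)" using obst_disjoint[OF ob p p] step[OF i] by metis
  consider "j = k i" | "j = k (Suc i)" | "j \<noteq> k i" "j \<noteq> k (Suc i)" by blast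
  then show ?thesis
  proof cases
    case 1
    have "q = p i" if q: "q \<in> obst Ob (k i)" "q \<in> closed_segment (p i) (p (Suc i))" for q
    proof (cases i)
      case 0
      then show ?thesis
        using segment_point_not_closer[OF q(2)] shortest_path_start[OF sp, of q] q i by simp
    next
      case (Suc n)
      show ?thesis
        using corner_point_not_advanced[of "p i" "p n" "p (Suc i)" q] q
          corner_not_straight[OF adm vis, of n] shortest_path_corner[OF sp, of n q] i
        by (simp add: Suc)
    qed
    then show ?thesis unfolding 1 by (intro segment_avoids_interior[OF ne]) auto
  next
    case 2
    have "q = p (Suc i)" if q: "q \<in> obst Ob (k (Suc i))" "q \<in> closed_segment (p (Suc i)) (p i)" for q
    proof (cases "Suc i = s")
      case True
      then show ?thesis
        using segment_point_not_closer[OF q(2)] shortest_path_end[of Ob k i p q] sp q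
        by (simp add: dist_commute)
    next
      case False
      then show ?thesis
        using corner_point_not_advanced[of "p (Suc i)" "p (Suc (Suc i))" "p i" q] q
          corner_not_straight[OF adm vis, of i] shortest_path_corner[OF sp, of i q] i
        by (simp add: closed_segment_commute dist_commute add.commute)
    qed
    then have "closed_segment (p (Suc i)) (p i) \<inter> interior (obst Ob j) = {}"
      unfolding 2 by (intro segment_avoids_interior[OF ne[symmetric]]) auto
    then show ?thesis by (simp add: closed_segment_commute)
  next
    case 3
    have "\<not> obst_between Ob j (k i) (k (Suc i))" using adm i by (auto simp: admissible_seq_def)
    then have "obst Ob j \<inter> convex hull (obst Ob (k i) \<union> obst Ob (k (Suc i))) = {}"
      using 3 by (auto simp: obst_between_def)
    then show ?thesis using segment_subset_hull[OF p p] interior_subset by blast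
  qed
qed

lemma shortest_path_is_trajectory:
  assumes ob: "torus_obstacle Ob" and adm: "admissible_seq Ob s k"
    and sp: "shortest_path Ob k s p" and "0 < s"
  shows "trajectory_piece Ob s k (p 0) (p s) (path_length s p)"
proof -
  have p: "p n \<in> obst Ob (k n)" for n using sp by (simp add: shortest_path_def visits_def)
  have vis: "visits Ob k p" using sp by (simp add: shortest_path_def)
  have step: "k (Suc n) \<noteq> k n" if "n < s" for n using adm that by (simp add: admissible_seq_def)
  have avoid: "closed_segment (p i) (p (Suc i)) \<inter> interior (obst Ob j) = {}" if "i < s" for i j
    using shortest_path_avoids_interiors[OF ob adm sp that] .
  have fr: "p i \<in> frontier (obst Ob (k i))" if i: "i \<le> s" for i
  proof -
    have "p i \<notin> interior (obst Ob (k i))"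
    proof (cases "i < s")
      case True
      then show ?thesis using avoid[of i "k i"] by auto
    next
      case False
      then obtain n where "i = Suc n" "n < s" using i \<open>0 < s\<close> by (cases i) auto
      then show ?thesis using avoid[of n "k i"] by auto
    qed
    then show ?thesis using p[of i] closure_subset by (auto simp: frontier_def)
  qed
  have refl: "reflects_at (obst Ob (k (Suc i))) (p i) (p (Suc i)) (p (Suc (Suc i)))"
    if i: "Suc i < s" for i
  proof (rule shortest_corner_reflects)
    show "p (Suc i) \<notin> closed_segment (p i) (p (Suc (Suc i)))"
      using corner_not_straight[OF adm vis i] .
    show "p (Suc i) \<noteq> p i" using obst_disjoint[OF ob p p] step[of i] i by auto
    show "p (Suc i) \<noteq> p (Suc (Suc i))" using obst_disjoint[OF ob p p] step[of "Suc i"] i by metis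
  qed (use i fr p smooth_boundary_obst[OF ob] shortest_path_corner[OF sp i] in auto)
  have refl': "reflects_at (obst Ob (0 + k i)) (p (i - 1)) (p i) (p (i + 1))"
    if "0 < i \<and> i < s" for i
    using refl[of "i - 1"] that by simp
  show ?thesis
    unfolding trajectory_piece_def
    by (intro exI[of _ 0] exI[of _ p]) (use fr avoid refl' in \<open>auto simp: path_length_def\<close>)
qed

section \<open>Admissible lattice walks\<close>

lemma norm_lattice_point_ge_1:
  fixes k :: "int ^ 'm"
  assumes "k \<noteq> 0"
  shows "1 \<le> norm (lattice_point k)"
proof -
  obtain i where "k $ i \<noteq> 0" using assms by (auto simp: vec_eq_iff)
  then have "1 \<le> \<bar>lattice_point k $ i\<bar>" by (simp add: lattice_point_def)
  then show ?thesis using component_le_norm_cart order_trans by blast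
qed

definition ternary :: "int ^ 'm \<Rightarrow> bool" where
  "ternary u \<longleftrightarrow> u \<noteq> 0 \<and> (\<forall>i. u $ i \<in> {-1, 0, 1})"

lemma ternary_minus [simp]: "ternary (- u) \<longleftrightarrow> ternary u"
  unfolding ternary_def by (simp, metis minus_equation_iff minus_zero)

lemma norm_ternary_le:
  fixes u :: "int ^ 'm"
  assumes "ternary u"
  shows "norm (lattice_point u) \<le> real CARD('m)"
proof -
  have "norm (lattice_point u) \<le> (\<Sum>i\<in>UNIV. \<bar>lattice_point u $ i\<bar>)" by (rule norm_le_l1_cart)
  also have "\<dots> \<le> (\<Sum>i\<in>(UNIV :: 'm set). 1)"
  proof (rule sum_mono)
    fix i
    have "u $ i \<in> {-1, 0, 1}" using assms by (simp add: ternary_def)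
    then show "\<bar>lattice_point u $ i\<bar> \<le> 1" by (auto simp: lattice_point_def)
  qed
  finally show ?thesis by simp
qed

text \<open>The obstacles lie within \<open>sqrt 2 / 4\<close> of their lattice points. So the hull stays that close to the
  segment of lattice points, and an obstacle meeting it has its centre within twice that distance.\<close>
lemma obst_between_imp_near_segment:
  fixes Ob :: "(real ^ 'm) set"
  assumes "small_obstacle Ob" "obst_between Ob k i j"
  shows "\<exists>q\<in>closed_segment (lattice_point i) (lattice_point j).
    (norm (lattice_point k - q))\<^sup>2 < 1 / 2"
proof -
  obtain r where r: "r < sqrt 2 / 4" "Ob \<subseteq> cball 0 r"
    using assms(1) by (auto simp: small_obstacle_def)
  let ?s = "closed_segment (lattice_point i) (lattice_point j)"
  define N where "N = (\<Union>x\<in>?s. \<Union>y\<in>cball (0 :: real ^ 'm) r. {x + y})"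
  have "convex N" unfolding N_def by (intro convex_sums) auto
  moreover have "obst Ob i \<union> obst Ob j \<subseteq> N"
    using r(2) by (force simp: N_def obst_def add.commute)
  ultimately have "convex hull (obst Ob i \<union> obst Ob j) \<subseteq> N" by (rule hull_minimal[rotated])
  then obtain y where y: "y \<in> obst Ob k" "y \<in> N"
    using assms(2) by (auto simp: obst_between_def)
  then obtain c where c: "c \<in> cball 0 r" "y = c + lattice_point k"
    using r(2) by (auto simp: obst_def)
  obtain q d where q: "q \<in> ?s" "d \<in> cball 0 r" "y = q + d" using y by (auto simp: N_def)
  have "lattice_point k - q = d - c" using c q by (simp add: algebra_simps)
  then have "norm (lattice_point k - q) \<le> 2 * r"
    using c(1) q(2) norm_triangle_ineq4[of d c] by simp
  moreover have "2 * r < sqrt 2 / 2" using r(1) by simp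
  ultimately have "norm (lattice_point k - q) < sqrt 2 / 2" by linarith
  then have "(norm (lattice_point k - q))\<^sup>2 < (sqrt 2 / 2)\<^sup>2"
    by (intro power_strict_mono) auto
  then show ?thesis using q(1) by (auto simp: power_divide)
qed

text \<open>The worst case is \<open>t = 1 / 2\<close>; this is where the bound \<open>sqrt 2 / 4\<close> on the radius comes from.\<close>
lemma two_sided_square_bound:
  fixes a b :: "real"
  assumes "0 \<le> t" "t \<le> 1" "1 \<le> a" "1 \<le> b"
  shows "1 / 2 \<le> (1 - t)\<^sup>2 * a + t\<^sup>2 * b"
proof -
  have "0 \<le> (2 * t - 1)\<^sup>2 / 2" by simp
  then have "1 / 2 \<le> (1 - t)\<^sup>2 + t\<^sup>2" by (simp add: power2_eq_square field_simps)
  moreover have "(1 - t)\<^sup>2 * 1 + t\<^sup>2 * 1 \<le> (1 - t)\<^sup>2 * a + t\<^sup>2 * b"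
    using assms by (intro add_mono mult_left_mono) auto
  ultimately show ?thesis by simp
qed

text \<open>A lattice point \<open>l\<close> other than \<open>0\<close> and \<open>u\<close> is at distance at least \<open>sqrt 2 / 2\<close> from the segment
  \<open>[0, u]\<close>: it differs from \<open>0\<close> in some coordinate and from \<open>u\<close> in some coordinate.\<close>
lemma ternary_step_unobstructed:
  fixes Ob :: "(real ^ 'm) set"
  assumes "small_obstacle Ob" "ternary u"
  shows "\<not> obst_between Ob j i (i + u)"
proof
  assume between: "obst_between Ob j i (i + u)"
  obtain q where q: "q \<in> closed_segment (lattice_point i) (lattice_point (i + u))"
    "(norm (lattice_point j - q))\<^sup>2 < 1 / 2"
    using obst_between_imp_near_segment[OF assms(1) between] by blast
  then obtain t where t: "0 \<le> t" "t \<le> 1" "q = lattice_point i + t *\<^sub>R lattice_point u"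
    by (auto simp: closed_segment_def lattice_point_add algebra_simps)
  define l where "l = j - i"
  have l: "l \<noteq> 0" "l \<noteq> u" using between by (auto simp: l_def obst_between_def algebra_simps)
  have jq: "lattice_point j - q = lattice_point l - t *\<^sub>R lattice_point u"
    by (simp add: t l_def lattice_point_diff)
  have sq: "(norm (lattice_point j - q))\<^sup>2 = (\<Sum>n\<in>UNIV. (real_of_int (l $ n) - t * real_of_int (u $ n))\<^sup>2)"
    by (simp only: jq power2_norm_eq_inner) (simp add: inner_vec_def power2_eq_square lattice_point_def)
  have "1 / 2 \<le> (\<Sum>n\<in>UNIV. (real_of_int (l $ n) - t * real_of_int (u $ n))\<^sup>2)"
  proof -
    \<comment> \<open>A coordinate where \<open>l\<close> leaves \<open>0\<close> costs at least \<open>(1 - t)\<^sup>2\<close>, one where it leaves \<open>u\<close> at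
      least \<open>t\<^sup>2\<close>, and one where it leaves both at least \<open>1\<close>.\<close>
    have "u $ n \<in> {-1, 0, 1}" for n using assms(2) by (simp add: ternary_def)
    then have cases: "u $ n = -1 \<or> u $ n = 0 \<or> u $ n = 1" for n by auto
    have cost01: "1 \<le> (real_of_int (l $ n) - t * real_of_int (u $ n))\<^sup>2" if "l $ n \<noteq> u $ n" "l $ n \<noteq> 0" for n
    proof -
      have "1 \<le> \<bar>real_of_int (l $ n) - t * real_of_int (u $ n)\<bar>"
      proof (cases "l $ n > 0")
        case True
        then have "1 \<le> real_of_int (l $ n)" "u $ n = 1 \<Longrightarrow> 2 \<le> real_of_int (l $ n)" using that by linarith+
        then show ?thesis using cases[of n] t by auto
      next
        case False
        then have "real_of_int (l $ n) \<le> -1" "u $ n = -1 \<Longrightarrow> real_of_int (l $ n) \<le> -2" using that by linarith+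
        then show ?thesis using cases[of n] t by auto
      qed
      then show ?thesis by (metis abs_le_square_iff abs_one one_power2)
    qed
    have unit: "(1 - t)\<^sup>2 \<le> 1" "t\<^sup>2 \<le> 1" using t by (simp_all add: power_le_one)
    have cost0: "(1 - t)\<^sup>2 \<le> (real_of_int (l $ n) - t * real_of_int (u $ n))\<^sup>2" if "l $ n \<noteq> 0" for n
    proof (cases "l $ n = u $ n")
      case True
      then show ?thesis using cases[of n] that by (auto simp: power2_commute)
    next
      case False
      then show ?thesis using cost01[of n] that unit by linarith
    qed
    have cost1: "t\<^sup>2 \<le> (real_of_int (l $ n) - t * real_of_int (u $ n))\<^sup>2" if "l $ n \<noteq> u $ n" for n
    proof (cases "l $ n = 0")
      case True
      then show ?thesis using cases[of n] that by auto
    next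
      case False
      then show ?thesis using cost01[of n] that unit by linarith
    qed
    obtain a where a: "l $ a \<noteq> 0" using l by (auto simp: vec_eq_iff)
    obtain b where b: "l $ b \<noteq> u $ b" using l by (auto simp: vec_eq_iff)
    show ?thesis
    proof (cases "a = b")
      case True
      have "1 \<le> (real_of_int (l $ a) - t * real_of_int (u $ a))\<^sup>2" using cost01 a b True by blast
      also have "\<dots> \<le> (\<Sum>n\<in>UNIV. (real_of_int (l $ n) - t * real_of_int (u $ n))\<^sup>2)"
        by (rule member_le_sum) auto
      finally show ?thesis by simp
    next
      case False
      have "1 / 2 \<le> (1 - t)\<^sup>2 + t\<^sup>2" using two_sided_square_bound[OF t(1,2), of 1 1] by simp
      also have "\<dots> \<le> (\<Sum>n\<in>{a, b}. (real_of_int (l $ n) - t * real_of_int (u $ n))\<^sup>2)"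
        using cost0[OF a] cost1[OF b] False by simp
      also have "\<dots> \<le> (\<Sum>n\<in>UNIV. (real_of_int (l $ n) - t * real_of_int (u $ n))\<^sup>2)"
        by (rule sum_mono2) auto
      finally show ?thesis .
    qed
  qed
  then show False using q(2) sq by linarith
qed

definition obtuse :: "int ^ 'm \<Rightarrow> int ^ 'm \<Rightarrow> bool" where
  "obtuse u w \<longleftrightarrow> lattice_point u \<bullet> lattice_point w \<le> 0"

text \<open>Relative to the middle centre, the segment between the outer ones joins \<open>- u\<close> to \<open>w\<close>. These vectors
  enclose an angle of at most a right one, so every point of the segment has squared norm at least
  \<open>(1 - t)\<^sup>2 * norm u ^ 2 + t\<^sup>2 * norm w ^ 2\<close>.\<close>
lemma obtuse_corner_unobstructed:
  fixes Ob :: "(real ^ 'm) set"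
  assumes "small_obstacle Ob" "u \<noteq> 0" "w \<noteq> 0" and turn: "obtuse u w"
  shows "\<not> obst_between Ob (i + u) i (i + u + w)"
proof
  assume between: "obst_between Ob (i + u) i (i + u + w)"
  let ?u = "lattice_point u" and ?w = "lattice_point w"
  obtain q where q: "q \<in> closed_segment (lattice_point i) (lattice_point (i + u + w))"
    "(norm (lattice_point (i + u) - q))\<^sup>2 < 1 / 2"
    using obst_between_imp_near_segment[OF assms(1) between] by blast
  then obtain t where t: "0 \<le> t" "t \<le> 1" "q = lattice_point i + t *\<^sub>R (?u + ?w)"
    by (auto simp: closed_segment_def lattice_point_add algebra_simps)
  have eq: "lattice_point (i + u) - q = (1 - t) *\<^sub>R ?u - t *\<^sub>R ?w"
    by (simp add: t lattice_point_add algebra_simps)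
  have "(norm (lattice_point (i + u) - q))\<^sup>2
    = (1 - t)\<^sup>2 * (norm ?u)\<^sup>2 + t\<^sup>2 * (norm ?w)\<^sup>2 - 2 * ((1 - t) * t * (?u \<bullet> ?w))"
    unfolding eq power2_norm_eq_inner
    by (simp add: inner_diff_left inner_diff_right inner_commute[of ?w ?u] power2_eq_square algebra_simps)
  moreover have "(1 - t) * t * (?u \<bullet> ?w) \<le> 0"
    using t turn by (intro mult_nonneg_nonpos) (auto simp: obtuse_def)
  moreover have "1 / 2 \<le> (1 - t)\<^sup>2 * (norm ?u)\<^sup>2 + t\<^sup>2 * (norm ?w)\<^sup>2"
    using t assms by (intro two_sided_square_bound one_le_power norm_lattice_point_ge_1)
  ultimately show False using q(2) by linarith
qed

lemma obtuse_ternary_steps_admissible: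
  fixes Ob :: "(real ^ 'm) set"
  assumes "small_obstacle Ob" "\<And>i. ternary (\<sigma> i)" "\<And>i. obtuse (\<sigma> i) (\<sigma> (Suc i))"
  shows "admissible_seq Ob s (\<lambda>n. \<Sum>i<n. \<sigma> i)"
proof -
  have nz: "\<sigma> i \<noteq> 0" for i using assms(2) by (simp add: ternary_def)
  have "\<not> obst_between Ob (\<Sum>i<n + 1. \<sigma> i) (\<Sum>i<n. \<sigma> i) (\<Sum>i<n + 2. \<sigma> i)" for n
    using obtuse_corner_unobstructed[OF assms(1) nz nz assms(3)] by simp
  then show ?thesis
    unfolding admissible_seq_def using nz ternary_step_unobstructed[OF assms(1,2)] by simp
qed

section \<open>The cone of attainable displacements\<close>

definition walk :: "(int ^ 'm) list \<Rightarrow> bool" where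
  "walk us \<longleftrightarrow> us \<noteq> [] \<and> (\<forall>u\<in>set us. ternary u) \<and> successively obtuse us"

definition walk_cost :: "(int ^ 'm) list \<Rightarrow> real" where
  "walk_cost us = (\<Sum>u\<leftarrow>us. norm (lattice_point u))"

lemma walk_cost_append [simp]: "walk_cost (us @ vs) = walk_cost us + walk_cost vs"
  by (simp add: walk_cost_def)

lemma obtuse_turn_back [simp]: "obtuse u (- u)" "obtuse (- u) u"
  by (simp_all add: obtuse_def lattice_point_minus)

text \<open>If the turn between the walks is acute, one step back at the end of the first walk makes both
  turns obtuse.\<close>
lemma walk_join:
  fixes us vs :: "(int ^ 'm) list"
  assumes "walk us" "walk vs"
  shows "\<exists>ws. walk ws \<and>
    norm (lattice_point (sum_list ws) - (lattice_point (sum_list us) + lattice_point (sum_list vs)))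
      \<le> real CARD('m) \<and>
    walk_cost ws \<le> walk_cost us + walk_cost vs + real CARD('m)"
proof (cases "obtuse (last us) (hd vs)")
  case True
  then have "walk (us @ vs)" using assms by (auto simp: walk_def successively_append_iff)
  then show ?thesis by (intro exI[of _ "us @ vs"]) (simp add: lattice_point_add)
next
  case False
  let ?b = "- last us"
  have "ternary (last us)" using assms by (simp add: walk_def)
  then have b: "ternary ?b" "norm (lattice_point ?b) \<le> real CARD('m)"
    using norm_ternary_le[of ?b] by simp_all
  have "obtuse ?b (hd vs)" using False by (simp add: obtuse_def lattice_point_minus)
  then have "walk (us @ [?b] @ vs)"
    using assms b by (auto simp: walk_def successively_append_iff successively_Cons)
  then show ?thesis
    using b(2)
    by (intro exI[of _ "us @ [?b] @ vs"])
      (simp add: lattice_point_add walk_cost_def lattice_point_diff lattice_point_minus)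
qed

text \<open>Walks with displacement \<open>L * v\<close> and cost at most \<open>L * c\<close> up to an error that does not depend on
  \<open>L\<close>. Bounded errors are what makes these pairs \<open>(v, c)\<close> a convex cone: concatenating walks adds
  the errors and a constant.\<close>
definition attainable :: "real ^ 'm \<Rightarrow> real \<Rightarrow> bool" where
  "attainable v c \<longleftrightarrow> (\<exists>K. \<forall>L\<ge>0. \<exists>us. walk us \<and>
     norm (lattice_point (sum_list us) - L *\<^sub>R v) \<le> K \<and> walk_cost us \<le> L * c + K)"

lemma attainable_scale:
  assumes "attainable v c" "0 \<le> a"
  shows "attainable (a *\<^sub>R v) (a * c)"
proof -
  obtain K where K: "\<And>L. 0 \<le> L \<Longrightarrow> \<exists>us. walk us \<and>
     norm (lattice_point (sum_list us) - L *\<^sub>R v) \<le> K \<and> walk_cost us \<le> L * c + K"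
    using assms(1) unfolding attainable_def by blast
  show ?thesis unfolding attainable_def
  proof (intro exI[of _ K] allI impI)
    fix L :: real assume "0 \<le> L"
    then show "\<exists>us. walk us \<and> norm (lattice_point (sum_list us) - L *\<^sub>R a *\<^sub>R v) \<le> K \<and>
        walk_cost us \<le> L * (a * c) + K"
      using K[of "L * a"] assms(2) by (simp add: mult.assoc)
  qed
qed

lemma attainable_mono:
  assumes "attainable v c" "c \<le> d"
  shows "attainable v d"
proof -
  obtain K where K: "\<And>L. 0 \<le> L \<Longrightarrow> \<exists>us. walk us \<and>
     norm (lattice_point (sum_list us) - L *\<^sub>R v) \<le> K \<and> walk_cost us \<le> L * c + K"
    using assms(1) unfolding attainable_def by blast
  show ?thesis unfolding attainable_def
  proof (intro exI[of _ K] allI impI)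
    fix L :: real assume "0 \<le> L"
    then have "L * c \<le> L * d" using assms(2) by (simp add: mult_left_mono)
    then show "\<exists>us. walk us \<and> norm (lattice_point (sum_list us) - L *\<^sub>R v) \<le> K \<and>
        walk_cost us \<le> L * d + K"
      using K[OF \<open>0 \<le> L\<close>] by (meson add_right_mono order_trans)
  qed
qed

lemma attainable_add:
  fixes v w :: "real ^ 'm"
  assumes "attainable v c" "attainable w d"
  shows "attainable (v + w) (c + d)"
proof -
  obtain K where K: "\<And>L. 0 \<le> L \<Longrightarrow> \<exists>us. walk us \<and>
     norm (lattice_point (sum_list us) - L *\<^sub>R v) \<le> K \<and> walk_cost us \<le> L * c + K"
    using assms(1) unfolding attainable_def by blast
  obtain J where J: "\<And>L. 0 \<le> L \<Longrightarrow> \<exists>us. walk us \<and>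
     norm (lattice_point (sum_list us) - L *\<^sub>R w) \<le> J \<and> walk_cost us \<le> L * d + J"
    using assms(2) unfolding attainable_def by blast
  show ?thesis unfolding attainable_def
  proof (intro exI[of _ "K + J + real CARD('m)"] allI impI)
    fix L :: real assume "0 \<le> L"
    obtain us where us: "walk us" "norm (lattice_point (sum_list us) - L *\<^sub>R v) \<le> K"
      "walk_cost us \<le> L * c + K" using K[OF \<open>0 \<le> L\<close>] by blast
    obtain vs where vs: "walk vs" "norm (lattice_point (sum_list vs) - L *\<^sub>R w) \<le> J"
      "walk_cost vs \<le> L * d + J" using J[OF \<open>0 \<le> L\<close>] by blast
    obtain ws where ws: "walk ws"
      "norm (lattice_point (sum_list ws) - (lattice_point (sum_list us) + lattice_point (sum_list vs)))
        \<le> real CARD('m)"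
      "walk_cost ws \<le> walk_cost us + walk_cost vs + real CARD('m)"
      using walk_join[OF us(1) vs(1)] by blast
    have "lattice_point (sum_list ws) - L *\<^sub>R (v + w)
      = (lattice_point (sum_list ws) - (lattice_point (sum_list us) + lattice_point (sum_list vs)))
        + (lattice_point (sum_list us) - L *\<^sub>R v) + (lattice_point (sum_list vs) - L *\<^sub>R w)"
      by (simp add: algebra_simps)
    then have "norm (lattice_point (sum_list ws) - L *\<^sub>R (v + w)) \<le> real CARD('m) + K + J"
      using ws(2) us(2) vs(2) by (metis add_mono norm_triangle_mono)
    moreover have "walk_cost ws \<le> L * (c + d) + (K + J + real CARD('m))"
      using ws(3) us(3) vs(3) by (simp add: distrib_left)
    ultimately show "\<exists>us. walk us \<and>
        norm (lattice_point (sum_list us) - L *\<^sub>R (v + w)) \<le> K + J + real CARD('m) \<and>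
        walk_cost us \<le> L * (c + d) + (K + J + real CARD('m))"
      using ws(1) by (intro exI[of _ ws]) simp
  qed
qed

lemma attainable_nonneg_combination:
  fixes v :: "'i \<Rightarrow> real ^ 'm"
  assumes "finite I" "I \<noteq> {}"
    and "\<And>i. i \<in> I \<Longrightarrow> 0 \<le> c i" "\<And>i. i \<in> I \<Longrightarrow> attainable (v i) (d i)"
  shows "attainable (\<Sum>i\<in>I. c i *\<^sub>R v i) (\<Sum>i\<in>I. c i * d i)"
  using assms
  by (induction I rule: finite_ne_induct) (simp_all add: attainable_scale attainable_add)

lemma walk_repeat_pair:
  assumes "ternary u" "ternary w" "obtuse u w" "obtuse w u"
  shows "walk (concat (replicate (Suc n) [u, w]))"
  using assms by (induction n) (auto simp: walk_def successively_Cons)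

text \<open>Both turns of the periodic walk \<open>u, w, u, w, \<dots>\<close> are right angles, and its cost per period is
  \<open>norm u + norm w \<le> sqrt 2 * norm (u + w)\<close> by Pythagoras. The factor \<open>sqrt 2\<close> is the price of
  the ban on straight corners.\<close>
lemma attainable_orthogonal_pair:
  fixes u w :: "int ^ 'm"
  assumes "ternary u" "ternary w" and orth: "lattice_point u \<bullet> lattice_point w = 0"
  shows "attainable (lattice_point u + lattice_point w)
    (sqrt 2 * norm (lattice_point u + lattice_point w))"
proof -
  let ?u = "lattice_point u" and ?w = "lattice_point w"
  define d where "d = norm ?u + norm ?w"
  have obt: "obtuse u w" "obtuse w u" using orth by (simp_all add: obtuse_def inner_commute)
  have sum: "lattice_point (sum_list (concat (replicate n [u, w]))) = real n *\<^sub>R (?u + ?w)" for n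
    by (induction n) (simp_all add: lattice_point_add algebra_simps)
  have cost: "walk_cost (concat (replicate n [u, w])) = real n * d" for n
    by (induction n) (simp_all add: walk_cost_def d_def algebra_simps)
  have "attainable (?u + ?w) d"
    unfolding attainable_def
  proof (intro exI[of _ d] allI impI)
    fix L :: real assume "0 \<le> L"
    define n where "n = Suc (nat \<lfloor>L\<rfloor>)"
    have n: "L \<le> real n" "real n \<le> L + 1" using \<open>0 \<le> L\<close> unfolding n_def by linarith+
    have "norm (lattice_point (sum_list (concat (replicate n [u, w]))) - L *\<^sub>R (?u + ?w))
        = (real n - L) * norm (?u + ?w)"
      unfolding sum scaleR_diff_left[symmetric] using n by simp
    also have "\<dots> \<le> 1 * d"
      using n norm_triangle_ineq[of ?u ?w] by (intro mult_mono) (auto simp: d_def)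
    finally have "norm (lattice_point (sum_list (concat (replicate n [u, w]))) - L *\<^sub>R (?u + ?w)) \<le> d"
      by simp
    moreover have "real n * d \<le> (L + 1) * d" using n by (intro mult_right_mono) (auto simp: d_def)
    ultimately show "\<exists>us. walk us \<and> norm (lattice_point (sum_list us) - L *\<^sub>R (?u + ?w)) \<le> d \<and>
        walk_cost us \<le> L * d + d"
      using walk_repeat_pair[OF assms(1,2) obt, of "nat \<lfloor>L\<rfloor>"]
      by (intro exI[of _ "concat (replicate n [u, w])"])
        (simp add: cost distrib_right n_def[symmetric] del: concat.simps replicate.simps)
  qed
  moreover have "d \<le> sqrt 2 * norm (?u + ?w)"
  proof -
    have "(norm (?u + ?w))\<^sup>2 = (norm ?u)\<^sup>2 + (norm ?w)\<^sup>2"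
      using orth by (simp add: power2_norm_eq_inner inner_add_left inner_add_right inner_commute)
    moreover have "0 \<le> (norm ?u - norm ?w)\<^sup>2" by simp
    ultimately have "d\<^sup>2 \<le> (sqrt 2 * norm (?u + ?w))\<^sup>2"
      by (simp add: d_def power_mult_distrib power2_sum power2_diff)
    then show ?thesis by (rule power2_le_imp_le) simp
  qed
  ultimately show ?thesis by (rule attainable_mono)
qed

lemma lattice_point_axis: "lattice_point (axis i c) = axis i (real_of_int c)"
  by (simp add: lattice_point_def axis_def vec_eq_iff)

text \<open>A ternary vector with at least two nonzero entries splits into two orthogonal ternary vectors.\<close>
lemma attainable_ternary:
  fixes z :: "int ^ 'm"
  assumes dim: "CARD('m) \<ge> 2" and z: "ternary z"
  shows "attainable (lattice_point z) (sqrt 2 * norm (lattice_point z))"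
proof -
  obtain i where i: "z $ i \<noteq> 0" using z by (auto simp: ternary_def vec_eq_iff)
  have val: "z $ n \<in> {-1, 0, 1}" for n using z by (simp add: ternary_def)
  show ?thesis
  proof (cases "\<exists>j. j \<noteq> i \<and> z $ j \<noteq> 0")
    case True
    then obtain j where j: "j \<noteq> i" "z $ j \<noteq> 0" by blast
    define u where "u = (axis i (z $ i) :: int ^ 'm)"
    define w where "w = z - u"
    have "ternary u" using i val[of i] by (auto simp: ternary_def u_def axis_def vec_eq_iff)
    moreover have "ternary w"
      using j val unfolding ternary_def w_def u_def by (auto simp: axis_def vec_eq_iff)
    moreover have "lattice_point u \<bullet> lattice_point w = 0"
    proof -
      have "lattice_point w $ i = 0" by (simp add: w_def u_def lattice_point_def axis_def)
      then show ?thesis by (simp add: u_def lattice_point_axis inner_axis')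
    qed
    ultimately have "attainable (lattice_point u + lattice_point w)
        (sqrt 2 * norm (lattice_point u + lattice_point w))"
      by (rule attainable_orthogonal_pair)
    then show ?thesis by (simp add: w_def lattice_point_diff)
  next
    case False
    \<comment> \<open>A coordinate vector cannot be split; borrow a second coordinate, which cancels after two steps.\<close>
    obtain j where j: "j \<noteq> i"
    proof -
      have "(UNIV :: 'm set) \<noteq> {i}"
      proof
        assume "(UNIV :: 'm set) = {i}"
        then have "CARD('m) = card {i}" by (rule arg_cong)
        then show False using dim by simp
      qed
      then show ?thesis using that by auto
    qed
    define e where "e = (axis j 1 :: int ^ 'm)"
    have z_eq: "z = axis i (z $ i)" using False by (auto simp: axis_def vec_eq_iff)
    have e_val: "e $ n = (if n = j then 1 else 0)" for n by (simp add: e_def axis_def)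
    have zj: "z $ j = 0" using False j by blast
    have val': "(z + e) $ n \<in> {-1, 0, 1} \<and> (z - e) $ n \<in> {-1, 0, 1}" for n
      using val[of n] zj by (auto simp: e_val)
    have "(z + e) $ i \<noteq> 0" "(z - e) $ i \<noteq> 0" using i j by (simp_all add: e_val)
    then have "z + e \<noteq> 0" "z - e \<noteq> 0" by (metis zero_index)+
    then have tern: "ternary (z + e)" "ternary (z - e)" using val' by (simp_all add: ternary_def)
    have "lattice_point z \<bullet> lattice_point z = 1"
      using val[of i] i by (subst (1 2) z_eq) (auto simp: lattice_point_axis inner_axis_axis)
    moreover have "lattice_point e \<bullet> lattice_point e = 1"
      by (simp add: e_def lattice_point_axis inner_axis_axis)
    ultimately have "lattice_point (z + e) \<bullet> lattice_point (z - e) = 0"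
      by (simp add: lattice_point_add lattice_point_diff inner_add_left inner_diff_right
          inner_commute[of "lattice_point e" "lattice_point z"])
    moreover have "lattice_point (z + e) + lattice_point (z - e) = 2 *\<^sub>R lattice_point z"
      by (simp add: lattice_point_add lattice_point_diff scaleR_2)
    ultimately have "attainable (2 *\<^sub>R lattice_point z) (sqrt 2 * norm (2 *\<^sub>R lattice_point z))"
      using attainable_orthogonal_pair[OF tern] by simp
    moreover have "sqrt 2 * norm (2 *\<^sub>R lattice_point z) = 2 * (sqrt 2 * norm (lattice_point z))"
      unfolding norm_scaleR by simp
    ultimately
    have "attainable (2 *\<^sub>R lattice_point z) (2 * (sqrt 2 * norm (lattice_point z)))"
      by (simp only:)
    from attainable_scale[OF this, of "1 / 2"] show ?thesis by simp
  qed
qed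

text \<open>The increment at \<open>k\<close> is \<open>1 / (sqrt (k + 1) + sqrt k)\<close>, at most \<open>1 / (2 * sqrt k)\<close>, so its square is
  at most \<open>(ln k - ln (k - 1)) / 4\<close> when \<open>k > 1\<close> and the sum telescopes. The first two terms
  contribute at most \<open>5 / 4\<close>.\<close>
lemma sum_sqrt_increments_squared:
  "(\<Sum>k<n + 2. (sqrt (real (Suc k)) - sqrt (real k))\<^sup>2) \<le> (ln (real (n + 1)) + 5) / 4"
proof (induction n)
  case 0
  have "(sqrt 2 - 1)\<^sup>2 = 3 - 2 * sqrt 2" by (simp add: power2_diff)
  moreover have "11 / 8 \<le> sqrt 2" by (rule real_le_rsqrt) (simp add: power2_eq_square)
  ultimately show ?case by (simp add: numeral_2_eq_2)
next
  case (Suc n)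
  define k where "k = n + 2"
  have k: "0 < real k" by (simp add: k_def)
  define b where "b = sqrt (real (Suc k)) - sqrt (real k)"
  have b: "0 \<le> b" by (simp add: b_def)
  have "b * (sqrt (real (Suc k)) + sqrt (real k)) = 1" by (simp add: b_def algebra_simps)
  moreover have "b * (2 * sqrt (real k)) \<le> b * (sqrt (real (Suc k)) + sqrt (real k))"
    using b by (intro mult_left_mono) auto
  ultimately have "b * (2 * sqrt (real k)) \<le> 1" by simp
  then have "(b * (2 * sqrt (real k)))\<^sup>2 \<le> 1\<^sup>2" using b by (intro power_mono) auto
  then have sq: "b\<^sup>2 \<le> (1 / real k) / 4" using k by (simp add: power_mult_distrib field_simps)
  have ln_step: "1 / real k \<le> ln (real k) - ln (real (k - 1))"
  proof -
    have "ln (real (k - 1) / real k) \<le> real (k - 1) / real k - 1"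
      by (rule ln_le_minus_one) (simp add: k_def)
    also have "\<dots> = - 1 / real k" by (simp add: k_def field_simps)
    finally show ?thesis by (simp add: ln_div k_def)
  qed
  have split: "(\<Sum>k<Suc n + 2. (sqrt (real (Suc k)) - sqrt (real k))\<^sup>2)
      = (\<Sum>k<n + 2. (sqrt (real (Suc k)) - sqrt (real k))\<^sup>2) + b\<^sup>2"
    unfolding b_def k_def by (simp only: add_Suc sum.lessThan_Suc)
  have combine: "S + B \<le> (x + 5) / 4" if "B \<le> r / 4" "r \<le> x - y" "S \<le> (y + 5) / 4"
    for S B r x y :: real
    using that by (simp add: field_simps)
  have "k - 1 = n + 1" "Suc n + 1 = k" by (simp_all add: k_def)
  then show ?case unfolding split using combine[OF sq ln_step] Suc by simp
qed

lemma sum_by_parts_decreasing: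
  fixes a b :: "nat \<Rightarrow> real"
  shows "(\<Sum>k<n. (a k - a (Suc k)) * b (Suc k)) = (\<Sum>k<n. a k * (b (Suc k) - b k)) + a 0 * b 0 - a n * b n"
  by (induction n) (simp_all add: algebra_simps)

text \<open>Sort the coordinates by decreasing absolute value, \<open>a 0 \<ge> a 1 \<ge> \<dots>\<close>. Then \<open>v\<close> is the sum of the
  vectors \<open>(a k - a (k + 1)) * z k\<close>, where \<open>z k\<close> carries the signs of \<open>v\<close> on the \<open>k + 1\<close> largest
  coordinates and has norm \<open>sqrt (k + 1)\<close>. Summation by parts turns the total weight into an inner
  product of \<open>a\<close> with the increments of the square root, and Cauchy-Schwarz applies.\<close>
lemma layer_cake_decomposition:
  fixes v :: "real ^ 'm"
  assumes dim: "CARD('m) \<ge> 2"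
  obtains c :: "nat \<Rightarrow> real" and z :: "nat \<Rightarrow> int ^ 'm" where
    "\<And>k. k < CARD('m) \<Longrightarrow> 0 \<le> c k \<and> ternary (z k)"
    "v = (\<Sum>k<CARD('m). c k *\<^sub>R lattice_point (z k))"
    "(\<Sum>k<CARD('m). c k * norm (lattice_point (z k))) \<le> norm v * sqrt ((ln (real CARD('m)) + 5) / 4)"
proof -
  let ?m = "CARD('m)"
  obtain xs :: "'m list" where xs: "set xs = UNIV" "distinct xs" 
    using finite_distinct_list[OF finite[of "UNIV :: 'm set"]] by blast
  define ys where "ys = sort_key (\<lambda>i. - \<bar>v $ i\<bar>) xs"
  have ys: "set ys = UNIV" "distinct ys" "sorted (map (\<lambda>i. - \<bar>v $ i\<bar>) ys)"
    using xs by (simp_all add: ys_def)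
  have len: "length ys = ?m" using distinct_card[OF ys(2)] ys(1) by simp
  \<comment> \<open>The value \<open>0\<close> at the end makes the last layer as thick as the smallest coordinate.\<close>
  define a where "a k = (if k < ?m then \<bar>v $ (ys ! k)\<bar> else 0)" for k
  define c where "c k = a k - a (Suc k)" for k
  \<comment> \<open>A vanishing coordinate counts as positive, so that every \<open>z k\<close> has exactly \<open>k + 1\<close> nonzero entries.\<close>
  define z where "z k = (\<chi> i. if i \<in> set (take (Suc k) ys) then (if v $ i < 0 then -1 else 1) else 0 :: int ^ 'm)" for k
  have c: "0 \<le> c k" for k
    using sorted_nth_mono[OF ys(3), of k "Suc k"] len by (auto simp: c_def a_def)
  have tern: "ternary (z k)" for k
  proof -
    have "ys \<noteq> []" using len by auto
    then have "ys ! 0 \<in> set (take (Suc k) ys)" by (cases ys) auto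
    then have "z k $ (ys ! 0) \<noteq> 0" by (simp add: z_def)
    then have "z k \<noteq> 0" by (metis zero_index)
    then show ?thesis by (simp add: ternary_def z_def)
  qed
  have nz: "norm (lattice_point (z k)) = sqrt (real (Suc k))" if "k < ?m" for k
  proof -
    have "lattice_point (z k) \<bullet> lattice_point (z k) = (\<Sum>i\<in>UNIV. if i \<in> set (take (Suc k) ys) then 1 else 0)"
      unfolding inner_vec_def by (intro sum.cong) (auto simp: lattice_point_def z_def)
    also have "\<dots> = real (card (set (take (Suc k) ys)))" by (simp add: sum.If_cases)
    also have "\<dots> = real (Suc k)" using distinct_card[of "take (Suc k) ys"] ys(2) len that by simp
    finally show ?thesis by (simp add: norm_eq_sqrt_inner)
  qed
  show ?thesis
  proof
    show "0 \<le> c k \<and> ternary (z k)" for k using c tern by blast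
    show "v = (\<Sum>k<?m. c k *\<^sub>R lattice_point (z k))"
      unfolding vec_eq_iff
    proof
      fix i
      obtain p where p: "p < ?m" "ys ! p = i" using ys(1) len by (metis UNIV_I in_set_conv_nth)
      define e :: real where "e = (if v $ i < 0 then -1 else 1)"
      have mem: "i \<in> set (take (Suc k) ys) \<longleftrightarrow> p \<le> k" for k
      proof
        assume "i \<in> set (take (Suc k) ys)"
        then obtain q where "q < Suc k" "q < ?m" "ys ! q = i" by (auto simp: in_set_conv_nth len)
        then have "q = p" using p ys(2) len by (metis nth_eq_iff_index_eq)
        then show "p \<le> k" using \<open>q < Suc k\<close> by simp
      next
        assume "p \<le> k"
        then show "i \<in> set (take (Suc k) ys)" using p len by (auto simp: in_set_conv_nth intro!: exI[of _ p])
      qed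
      have "(\<Sum>k<?m. c k *\<^sub>R lattice_point (z k)) $ i = (\<Sum>k<?m. if p \<le> k then c k * e else 0)"
        unfolding sum_component by (intro sum.cong) (auto simp: lattice_point_def z_def mem e_def)
      also have "\<dots> = (\<Sum>k\<in>{p..<?m}. c k * e)"
        by (intro sum.mono_neutral_cong_right) auto
      also have "\<dots> = - (\<Sum>k\<in>{p..<?m}. a (Suc k) - a k) * e"
        by (simp add: c_def sum_distrib_right sum_negf[symmetric])
      also have "\<dots> = a p * e"
      proof -
        have "(\<Sum>k\<in>{p..<?m}. a (Suc k) - a k) = a ?m - a p"
          by (rule sum_Suc_diff') (use p in simp)
        then show ?thesis by (simp add: a_def)
      qed
      also have "\<dots> = v $ i" using p by (simp add: a_def e_def)
      finally show "v $ i = (\<Sum>k<?m. c k *\<^sub>R lattice_point (z k)) $ i" by simp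
    qed
    define b where "b k = sqrt (real k)" for k
    have "(\<Sum>k<?m. c k * norm (lattice_point (z k))) = (\<Sum>k<?m. (a k - a (Suc k)) * b (Suc k))"
      by (intro sum.cong) (simp_all add: nz c_def b_def)
    also have "\<dots> = (\<Sum>k<?m. a k * (b (Suc k) - b k))"
      by (simp add: sum_by_parts_decreasing) (simp add: a_def b_def)
    also have "\<dots> \<le> (\<Sum>k<?m. \<bar>a k\<bar> * \<bar>b (Suc k) - b k\<bar>)"
      by (intro sum_mono) (simp add: abs_mult[symmetric])
    also have "\<dots> \<le> L2_set a {..<?m} * L2_set (\<lambda>k. b (Suc k) - b k) {..<?m}"
      by (rule L2_set_mult_ineq)
    also have "\<dots> \<le> norm v * sqrt ((ln (real ?m) + 5) / 4)"
    proof (intro mult_mono)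
      have "bij_betw ((!) ys) {..<?m} UNIV" using bij_betw_nth[OF ys(2), of "{..<?m}" UNIV] len ys(1) by simp
      then have "(\<Sum>k<?m. (v $ (ys ! k))\<^sup>2) = (\<Sum>i\<in>UNIV. (v $ i)\<^sup>2)" by (rule sum.reindex_bij_betw)
      then show "L2_set a {..<?m} \<le> norm v" by (simp add: L2_set_def norm_vec_def a_def)
      obtain n where n: "?m = n + 2" using dim by (metis add.commute le_Suc_ex)
      have "(\<Sum>k<?m. (b (Suc k) - b k)\<^sup>2) \<le> (ln (real (n + 1)) + 5) / 4"
        unfolding n b_def by (rule sum_sqrt_increments_squared)
      also have "\<dots> \<le> (ln (real ?m) + 5) / 4" unfolding n by simp
      finally show "L2_set (\<lambda>k. b (Suc k) - b k) {..<?m} \<le> sqrt ((ln (real ?m) + 5) / 4)"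
        by (simp add: L2_set_def)
    qed (auto simp: L2_set_nonneg)
    finally show "(\<Sum>k<?m. c k * norm (lattice_point (z k))) \<le> norm v * sqrt ((ln (real ?m) + 5) / 4)" .
  qed
qed

lemma attainable_ball:
  fixes v :: "real ^ 'm"
  assumes dim: "CARD('m) \<ge> 2" and v: "v \<in> cball 0 (sqrt (2 / (ln (real CARD('m)) + 5)))"
  shows "attainable v 1"
proof -
  let ?m = "CARD('m)" and ?S = "ln (real CARD('m)) + 5"
  obtain c :: "nat \<Rightarrow> real" and z :: "nat \<Rightarrow> int ^ 'm" where cz:
    "\<And>k. k < ?m \<Longrightarrow> 0 \<le> c k \<and> ternary (z k)"
    "v = (\<Sum>k<?m. c k *\<^sub>R lattice_point (z k))"
    "(\<Sum>k<?m. c k * norm (lattice_point (z k))) \<le> norm v * sqrt (?S / 4)"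
    using layer_cake_decomposition[OF dim] by blast
  have "attainable (\<Sum>k<?m. c k *\<^sub>R lattice_point (z k)) (\<Sum>k<?m. c k * (sqrt 2 * norm (lattice_point (z k))))"
  proof (rule attainable_nonneg_combination)
    have "0 \<in> {..<?m}" by simp
    then show "{..<?m} \<noteq> {}" by blast
  qed (use cz(1) attainable_ternary[OF dim] in auto)
  moreover have "(\<Sum>k<?m. c k * (sqrt 2 * norm (lattice_point (z k)))) \<le> 1"
  proof -
    have S: "0 < ?S" using dim by (intro add_nonneg_pos) auto
    have "(\<Sum>k<?m. c k * (sqrt 2 * norm (lattice_point (z k))))
        = sqrt 2 * (\<Sum>k<?m. c k * norm (lattice_point (z k)))"
      by (simp add: sum_distrib_left mult.left_commute)
    also have "\<dots> \<le> sqrt 2 * (sqrt (2 / ?S) * sqrt (?S / 4))"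
      using cz(3) v S by (intro mult_left_mono order_trans[OF cz(3)] mult_right_mono) auto
    also have "\<dots> = sqrt (2 * (2 / ?S * (?S / 4)))" by (simp only: real_sqrt_mult)
    also have "2 * (2 / ?S * (?S / 4)) = 1" using S by simp
    finally show ?thesis by simp
  qed
  ultimately show ?thesis unfolding cz(2)[symmetric] by (rule attainable_mono)
qed

section \<open>Trajectories of prescribed length\<close>

text \<open>The value \<open>3 / 8\<close> is a rational bound above \<open>sqrt 2 / 4\<close> and below one half, so that two obstacles
  stay a positive distance apart.\<close>
lemma small_obstacle_dist_center:
  assumes "small_obstacle Ob" "x \<in> obst Ob k"
  shows "dist x (lattice_point k) \<le> 3 / 8"
proof -
  have "sqrt 2 \<le> 3 / 2" by (rule real_le_lsqrt) (simp_all add: power2_eq_square)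
  then show ?thesis using assms by (force simp: small_obstacle_def obst_def dist_norm)
qed

text \<open>Going back and forth along the last step of a walk consumes time without displacement. This is how
  a trajectory that is too fast is slowed down.\<close>
lemma walk_extends_to_infinite_steps:
  fixes us :: "(int ^ 'm) list"
  assumes "walk us"
  obtains \<sigma> :: "nat \<Rightarrow> int ^ 'm" where
    "\<And>i. ternary (\<sigma> i)" "\<And>i. obtuse (\<sigma> i) (\<sigma> (Suc i))"
    "(\<Sum>i<length us. \<sigma> i) = sum_list us"
    "(\<Sum>i<length us. norm (lattice_point (\<sigma> i))) = walk_cost us"
    "\<And>s. length us \<le> s \<Longrightarrow>
      norm (lattice_point (\<Sum>i<s. \<sigma> i) - lattice_point (sum_list us)) \<le> real CARD('m)"
proof -
  define n where "n = length us"
  define w where "w = last us"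
  define \<sigma> where "\<sigma> i = (if i < n then us ! i else if even (i - n) then - w else w)" for i
  have us: "us \<noteq> []" "\<And>u. u \<in> set us \<Longrightarrow> ternary u" "successively obtuse us"
    using assms by (simp_all add: walk_def)
  have w: "ternary w" "us ! (n - 1) = w" "0 < n"
    using us by (simp_all add: w_def n_def last_conv_nth)
  have tern: "ternary (\<sigma> i)" for i using us w by (simp add: \<sigma>_def n_def)
  have obt: "obtuse (\<sigma> i) (\<sigma> (Suc i))" for i
  proof -
    consider "Suc i < n" | "Suc i = n" | "n \<le> i" by linarith
    then show ?thesis
    proof cases
      case 1
      then show ?thesis using successively_nth[OF us(3)] by (simp add: \<sigma>_def n_def)
    next
      case 2
      then have "us ! i = w" using w by auto
      then show ?thesis using 2 by (auto simp: \<sigma>_def)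
    next
      case 3
      then show ?thesis by (simp add: \<sigma>_def Suc_diff_le)
    qed
  qed
  have start: "(\<Sum>i<n. \<sigma> i) = sum_list us"
    by (simp add: sum_list_sum_nth atLeast0LessThan n_def \<sigma>_def)
  have cost: "(\<Sum>i<n. norm (lattice_point (\<sigma> i))) = walk_cost us"
    unfolding walk_cost_def by (simp add: sum_list_sum_nth atLeast0LessThan n_def \<sigma>_def)
  have later: "(\<Sum>i<n + j. \<sigma> i) = sum_list us + (if even j then 0 else - w)" for j
    by (induction j) (simp_all add: start, simp_all add: \<sigma>_def)
  have near: "norm (lattice_point (\<Sum>i<s. \<sigma> i) - lattice_point (sum_list us)) \<le> real CARD('m)"
    if ge: "n \<le> s" for s
  proof -
    obtain j where "s = n + j" using le_Suc_ex[OF ge] by blast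
    then show ?thesis
      using norm_ternary_le[OF w(1)] by (simp add: later lattice_point_add lattice_point_minus lattice_point_diff)
  qed
  show ?thesis
    by (rule that[of \<sigma>, OF tern obt start[unfolded n_def] cost[unfolded n_def] near[unfolded n_def]])
qed

definition shortest_length :: "(real ^ 'm) set \<Rightarrow> (nat \<Rightarrow> int ^ 'm) \<Rightarrow> nat \<Rightarrow> real" where
  "shortest_length Ob k s = path_length s (SOME p. shortest_path Ob k s p)"

lemma shortest_lengthE:
  assumes "torus_obstacle Ob"
  obtains p where "shortest_path Ob k s p" "path_length s p = shortest_length Ob k s"
  using someI_ex[OF shortest_path_exists[OF assms]] unfolding shortest_length_def by metis

lemma shortest_length_le:
  assumes "torus_obstacle Ob" "visits Ob k p"
  shows "shortest_length Ob k s \<le> path_length s p"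
  using shortest_lengthE[OF assms(1), of k s] assms(2) unfolding shortest_path_def by metis

lemma path_length_Suc: "path_length (Suc s) p = path_length s p + dist (p s) (p (Suc s))"
  by (simp add: path_length_def)

lemma shortest_length_Suc_le:
  assumes ob: "torus_obstacle Ob" "small_obstacle Ob"
  shows "shortest_length Ob k (Suc s)
    \<le> shortest_length Ob k s + norm (lattice_point (k (Suc s) - k s)) + 1"
proof -
  obtain p where p: "shortest_path Ob k s p" "path_length s p = shortest_length Ob k s"
    using shortest_lengthE[OF ob(1)] by blast
  then have vis: "p i \<in> obst Ob (k i)" for i by (simp add: shortest_path_def visits_def)
  have "shortest_length Ob k (Suc s) \<le> path_length s p + dist (p s) (p (Suc s))"
    using shortest_length_le[OF ob(1)] vis path_length_Suc by (metis visits_def)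
  moreover have "dist (p s) (p (Suc s)) \<le> norm (lattice_point (k (Suc s) - k s)) + 1"
    using small_obstacle_dist_center[OF ob(2) vis[of s]]
      small_obstacle_dist_center[OF ob(2) vis[of "Suc s"]]
    unfolding lattice_point_diff dist_norm
    by norm
  ultimately show ?thesis using p by simp
qed

lemma shortest_length_Suc_ge:
  assumes ob: "torus_obstacle Ob" "small_obstacle Ob" and "k (Suc s) \<noteq> k s"
  shows "shortest_length Ob k s + 1 / 4 \<le> shortest_length Ob k (Suc s)"
proof -
  obtain p where p: "shortest_path Ob k (Suc s) p"
    "path_length (Suc s) p = shortest_length Ob k (Suc s)"
    using shortest_lengthE[OF ob(1)] by blast
  then have vis: "p i \<in> obst Ob (k i)" for i by (simp add: shortest_path_def visits_def)
  have "1 \<le> norm (lattice_point (k (Suc s) - k s))"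
    using assms(3) by (intro norm_lattice_point_ge_1) simp
  then have "1 / 4 \<le> dist (p s) (p (Suc s))"
    using small_obstacle_dist_center[OF ob(2) vis[of s]]
      small_obstacle_dist_center[OF ob(2) vis[of "Suc s"]]
    unfolding lattice_point_diff dist_norm
    by norm
  moreover have "shortest_length Ob k s \<le> path_length s p"
    using p by (intro shortest_length_le ob) (simp add: shortest_path_def)
  ultimately show ?thesis using p(2) path_length_Suc[of s p] by linarith
qed

text \<open>Join translates of one and the same point of the obstacle.\<close>
lemma shortest_length_le_step_norms:
  assumes "torus_obstacle Ob"
  shows "shortest_length Ob k s \<le> (\<Sum>i<s. norm (lattice_point (k (Suc i) - k i)))"
proof -
  obtain c where "c \<in> Ob" using obst_nonempty[OF assms, of 0] by (auto simp: obst_def)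
  define p where "p i = c + lattice_point (k i)" for i
  have "visits Ob k p" using \<open>c \<in> Ob\<close> by (auto simp: visits_def p_def obst_def)
  moreover have "path_length s p = (\<Sum>i<s. norm (lattice_point (k (Suc i) - k i)))"
    by (simp add: path_length_def p_def dist_norm lattice_point_diff norm_minus_commute)
  ultimately show ?thesis using shortest_length_le[OF assms] by metis
qed

text \<open>A walk for \<open>L * v\<close> has a shortest path of length at most \<open>L\<close> up to a constant. While that length is
  below \<open>L\<close>, extend the walk back and forth: each step increases the shortest length by an amount
  bounded above and below, so it can be stopped just beyond \<open>L\<close>.\<close>
lemma attainable_trajectory_of_length:
  fixes Ob :: "(real ^ 'm) set"
  assumes ob: "torus_obstacle Ob" "small_obstacle Ob" and v: "attainable v 1"
  shows "\<exists>K. \<forall>L\<ge>0. \<exists>s k x y t. admissible_seq Ob s k \<and> trajectory_piece Ob s k x y t \<and>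
    L \<le> t \<and> t \<le> L + K \<and> norm ((y - x) - L *\<^sub>R v) \<le> K"
proof -
  let ?m = "real CARD('m)"
  obtain K where K: "\<And>L. 0 \<le> L \<Longrightarrow> \<exists>us. walk us \<and>
     norm (lattice_point (sum_list us) - L *\<^sub>R v) \<le> K \<and> walk_cost us \<le> L * 1 + K"
    using v unfolding attainable_def by blast
  have "0 \<le> K" using K[of 0] norm_ge_zero order_trans by blast
  show ?thesis
  proof (intro exI[of _ "K + ?m + 1"] allI impI)
    fix L :: real assume "0 \<le> L"
    obtain us where us: "walk us" "norm (lattice_point (sum_list us) - L *\<^sub>R v) \<le> K"
      "walk_cost us \<le> L + K" using K[OF \<open>0 \<le> L\<close>] by auto
    define n where "n = length us"
    have "0 < n" using us by (simp add: n_def walk_def)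
    obtain \<sigma> where \<sigma>: "\<And>i. ternary (\<sigma> i)" "\<And>i. obtuse (\<sigma> i) (\<sigma> (Suc i))"
      "(\<Sum>i<n. \<sigma> i) = sum_list us" "(\<Sum>i<n. norm (lattice_point (\<sigma> i))) = walk_cost us"
      "\<And>s. n \<le> s \<Longrightarrow> norm (lattice_point (\<Sum>i<s. \<sigma> i) - lattice_point (sum_list us)) \<le> ?m"
      using walk_extends_to_infinite_steps[OF us(1)] unfolding n_def by metis
    define k where "k = (\<lambda>s. \<Sum>i<s. \<sigma> i)"
    have step: "k (Suc s) - k s = \<sigma> s" for s by (simp add: k_def)
    have "k (Suc s) \<noteq> k s" for s using \<sigma>(1)[of s] step[of s] by (auto simp: ternary_def)
    then have grow: "shortest_length Ob k s + 1 / 4 \<le> shortest_length Ob k (Suc s)" for s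
      using shortest_length_Suc_ge[OF ob] by blast
    have bounded: "shortest_length Ob k (Suc s) \<le> shortest_length Ob k s + ?m + 1" for s
      using shortest_length_Suc_le[OF ob, of k s] norm_ternary_le[OF \<sigma>(1)[of s]] unfolding step by linarith
    have lin: "real s / 4 \<le> shortest_length Ob k s" for s
    proof (induction s)
      case 0
      show ?case by (simp add: shortest_length_def path_length_def)
    next
      case (Suc s)
      then show ?case using grow[of s] by simp
    qed
    obtain N :: nat where "4 * L < real N" using reals_Archimedean2 by blast
    then have "L \<le> shortest_length Ob k (max n N)" using lin[of "max n N"] by simp
    then have ex: "\<exists>s. n \<le> s \<and> L \<le> shortest_length Ob k s" by (intro exI[of _ "max n N"]) simp
    define s where "s = (LEAST s. n \<le> s \<and> L \<le> shortest_length Ob k s)"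
    have s: "n \<le> s" "L \<le> shortest_length Ob k s" using LeastI_ex[OF ex] by (simp_all add: s_def)
    have least: "shortest_length Ob k r < L" if "n \<le> r" "r < s" for r
      using not_less_Least[of r "\<lambda>s. n \<le> s \<and> L \<le> shortest_length Ob k s"] that by (force simp: s_def)
    have upper: "shortest_length Ob k s \<le> L + (K + ?m + 1)"
    proof (cases "s = n")
      case True
      have "shortest_length Ob k n \<le> walk_cost us"
        using shortest_length_le_step_norms[OF ob(1), of k n] unfolding step \<sigma>(4) .
      then show ?thesis using us(3) True by simp
    next
      case False
      then obtain r where "s = Suc r" "n \<le> r" using s(1) by (cases s) auto
      then show ?thesis using least[of r] bounded[of r] \<open>0 \<le> K\<close> by simp
    qed
    obtain p where p: "shortest_path Ob k s p" "path_length s p = shortest_length Ob k s"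
      using shortest_lengthE[OF ob(1)] by blast
    have adm: "admissible_seq Ob s k"
      using obtuse_ternary_steps_admissible[OF ob(2), of \<sigma>, OF \<sigma>(1,2)] unfolding k_def .
    have "trajectory_piece Ob s k (p 0) (p s) (path_length s p)"
      using shortest_path_is_trajectory[OF ob(1) adm p(1)] s \<open>0 < n\<close> by simp
    moreover have "norm ((p s - p 0) - L *\<^sub>R v) \<le> K + ?m + 1"
    proof -
      have vis: "p i \<in> obst Ob (k i)" for i using p by (simp add: shortest_path_def visits_def)
      have "dist (p s) (lattice_point (k s)) \<le> 3 / 8" by (rule small_obstacle_dist_center[OF ob(2) vis])
      moreover have "dist (p 0) 0 \<le> 3 / 8"
        using small_obstacle_dist_center[OF ob(2) vis[of 0]] by (simp add: k_def)
      moreover have "norm (lattice_point (k s) - lattice_point (sum_list us)) \<le> ?m"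
        using \<sigma>(5)[OF s(1)] by (simp add: k_def)
      moreover have "norm (a - c - w) \<le> K + ?m + 1"
        if "norm (a - b) \<le> 3 / 8" "norm (c - 0) \<le> 3 / 8" "norm (b - d) \<le> ?m" "norm (d - w) \<le> K"
        for a b c d w :: "real ^ 'm"
        using that by norm
      ultimately show ?thesis using us(2) unfolding dist_norm by blast
    qed
    ultimately show "\<exists>s k x y t. admissible_seq Ob s k \<and> trajectory_piece Ob s k x y t \<and>
        L \<le> t \<and> t \<le> L + (K + ?m + 1) \<and> norm ((y - x) - L *\<^sub>R v) \<le> K + ?m + 1"
      using adm s(2) upper p(2) by metis
  qed
qed

lemma attainable_in_admissible_rotation_set:
  fixes Ob :: "(real ^ 'm) set"
  assumes ob: "torus_obstacle Ob" "small_obstacle Ob" and v: "attainable v 1"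
  shows "v \<in> admissible_rotation_set Ob"
proof -
  obtain K where K: "\<And>L. 0 \<le> L \<Longrightarrow> \<exists>x y t. (\<exists>s k. admissible_seq Ob s k \<and> trajectory_piece Ob s k x y t) \<and>
    L \<le> t \<and> t \<le> L + K \<and> norm ((y - x) - L *\<^sub>R v) \<le> K"
    using attainable_trajectory_of_length[OF assms] by meson
  have "\<forall>n::nat. \<exists>x y t. (\<exists>s k. admissible_seq Ob s k \<and> trajectory_piece Ob s k x y t) \<and>
    real (Suc n) \<le> t \<and> t \<le> real (Suc n) + K \<and> norm ((y - x) - real (Suc n) *\<^sub>R v) \<le> K"
    by (intro allI K) simp
  then obtain x y t where xyt:
    "\<And>n. \<exists>s k. admissible_seq Ob s k \<and> trajectory_piece Ob s k (x n) (y n) (t n)"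
    "\<And>n. real (Suc n) \<le> t n" "\<And>n. t n \<le> real (Suc n) + K"
    "\<And>n. norm ((y n - x n) - real (Suc n) *\<^sub>R v) \<le> K"
    by metis
  have "filterlim t at_top sequentially"
    by (rule filterlim_at_top_mono[OF filterlim_real_sequentially])
      (use xyt(2) in \<open>auto intro!: always_eventually order_trans[OF _ xyt(2)]\<close>)
  moreover have "(\<lambda>n. (y n - x n) /\<^sub>R t n) \<longlonglongrightarrow> v"
  proof (rule LIM_zero_cancel, rule Lim_null_comparison)
    let ?C = "K * (1 + norm v)"
    show "(\<lambda>n. ?C * inverse (real (Suc n))) \<longlonglongrightarrow> 0"
      by (intro tendsto_mult_right_zero LIMSEQ_inverse_real_of_nat)
    have "norm ((y n - x n) /\<^sub>R t n - v) \<le> ?C * inverse (real (Suc n))" for n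
    proof -
      have pos: "0 < t n" using xyt(2)[of n] by linarith
      have "(y n - x n) /\<^sub>R t n - v = (((y n - x n) - real (Suc n) *\<^sub>R v) - (t n - real (Suc n)) *\<^sub>R v) /\<^sub>R t n"
        using pos by (simp add: algebra_simps)
      also have "norm \<dots> = norm (((y n - x n) - real (Suc n) *\<^sub>R v) - (t n - real (Suc n)) *\<^sub>R v) * inverse (t n)"
        using pos by simp
      also have "\<dots> \<le> ?C * inverse (real (Suc n))"
      proof (rule mult_mono)
        have "norm (((y n - x n) - real (Suc n) *\<^sub>R v) - (t n - real (Suc n)) *\<^sub>R v)
            \<le> norm ((y n - x n) - real (Suc n) *\<^sub>R v) + norm ((t n - real (Suc n)) *\<^sub>R v)"
          by (rule norm_triangle_ineq4)
        also have "\<dots> \<le> K + K * norm v"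
          using xyt(2-4)[of n] by (intro add_mono) (auto intro!: mult_right_mono)
        finally show "norm (((y n - x n) - real (Suc n) *\<^sub>R v) - (t n - real (Suc n)) *\<^sub>R v) \<le> ?C"
          by (simp add: distrib_left)
        show "inverse (t n) \<le> inverse (real (Suc n))" using xyt(2)[of n] by (intro le_imp_inverse_le) auto
        have "0 \<le> K" using xyt(4)[of n] norm_ge_zero order_trans by blast
        then show "0 \<le> ?C" by simp
      qed (use pos in simp)
      finally show ?thesis .
    qed
    then show "\<forall>\<^sub>F n in sequentially. norm ((y n - x n) /\<^sub>R t n - v) \<le> ?C * inverse (real (Suc n))"
      by (rule always_eventually[OF allI])
  qed
  ultimately show ?thesis unfolding admissible_rotation_set_def using xyt(1) by blast
qed

theorem theorem4p2:
  fixes Ob :: "(real ^ 'm) set"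
  assumes "CARD('m) \<ge> 2"
    and "torus_obstacle Ob"
    and "small_obstacle Ob"
  shows "cball 0 (sqrt (2 / (ln (real CARD('m)) + 5))) \<subseteq> admissible_rotation_set Ob"
  using attainable_in_admissible_rotation_set[OF assms(2,3)] attainable_ball[OF assms(1)] by blast

end
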